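(* Let $\lambda,\mu$ be partitions, and consider the Littlewood-Richardson expansion of the product of two Schur polynomials in the ring of symmetric functions, $$S_\lambda S_\mu=\sum_\nu c^{\nu}_{\lambda,\mu}S_\nu .$$ Then $$\sum_\nu c^{\nu}_{\lambda,\mu}=\sum_{\alpha,\beta,\nu}c^{\lambda}_{\alpha,\nu}\,c^{\mu}_{\beta,\nu},$$ where the sum on the right runs over all triples of partitions $\alpha,\beta,\nu$.
   Context: $S_\lambda$ denotes the Schur function of the partition $\lambda$, and $c^{\nu}_{\lambda,\mu}$ are the Littlewood-Richardson coefficients, i.e. the structure constants of the ring of symmetric functions in the Schur basis. *)

theory Defs
  imports Main "HOL-Library.FuncSet" "HOL-Library.Poly_Mapping"
begin

typedef partition = "{xs :: nat list. sorted_wrt (\<ge>) xs \<and> 0 \<notin> set xs}"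
  morphisms parts Abs_partition
  by (rule exI[of _ "[]"]) simp

text \<open>Young diagrams in English notation; rows and columns are indexed from 0.\<close>

definition diagram :: "partition \<Rightarrow> (nat \<times> nat) set" where
  "diagram la = {(i, j). i < length (parts la) \<and> j < parts la ! i}"

text \<open>
  Tableaux are extensional functions on the diagram, so that each filling is counted once.
\<close>

definition semistandard_tableaux :: "partition \<Rightarrow> (nat \<times> nat \<Rightarrow> nat) set" where
  "semistandard_tableaux la = {T \<in> diagram la \<rightarrow>\<^sub>E UNIV.
     (\<forall>i j j'. (i, j) \<in> diagram la \<and> (i, j') \<in> diagram la \<and> j < j' \<longrightarrow> T (i, j) \<le> T (i, j')) \<and>
     (\<forall>i i' j. (i, j) \<in> diagram la \<and> (i', j) \<in> diagram la \<and> i < i' \<longrightarrow> T (i, j) < T (i', j))}"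

text \<open>
  The ring of symmetric functions is a subring of the formal power series with integer
  coefficients in the variables \<open>x\<^sub>0, x\<^sub>1, \<dots>\<close>. A monomial is given by its finitely
  supported exponent vector, and a power series by its coefficient function. The product is the
  Cauchy product; each coefficient is a finite sum.
\<close>

type_synonym monom = "nat \<Rightarrow>\<^sub>0 nat"
type_synonym power_series = "monom \<Rightarrow> int"

definition series_mult :: "power_series \<Rightarrow> power_series \<Rightarrow> power_series" where
  "series_mult f g = (\<lambda>m. \<Sum>(a, b) \<in> {(a, b). a + b = m}. f a * g b)"

text \<open>The exponent vector of the monomial \<open>\<Prod>c. x\<^bsub>T c\<^esub>\<close>.\<close>

definition tableau_weight :: "partition \<Rightarrow> (nat \<times> nat \<Rightarrow> nat) \<Rightarrow> monom" where
  "tableau_weight la T = (\<Sum>c \<in> diagram la. Poly_Mapping.single (T c) 1)"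

definition schur :: "partition \<Rightarrow> power_series" where
  "schur la = (\<lambda>m. int (card {T \<in> semistandard_tableaux la. tableau_weight la T = m}))"

definition schur_expansion :: "power_series \<Rightarrow> (partition \<Rightarrow> int) \<Rightarrow> bool" where
  "schur_expansion f c \<longleftrightarrow>
     finite {nu. c nu \<noteq> 0} \<and> f = (\<lambda>m. \<Sum>nu \<in> {nu. c nu \<noteq> 0}. c nu * schur nu m)"

text \<open>
  \<open>lr_coeff la mu nu\<close> is the coefficient of \<open>schur nu\<close> in the product of \<open>schur la\<close> and
  \<open>schur mu\<close>; the upper index of the usual notation comes last.
\<close>

definition lr_coeff :: "partition \<Rightarrow> partition \<Rightarrow> partition \<Rightarrow> int" where
  "lr_coeff la mu = (THE c. schur_expansion (series_mult (schur la) (schur mu)) c)"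

end

theory Submission
  imports Defs
begin

text \<open>
Let \<open>\<epsilon>\<close> be the linear functional on symmetric functions with
\<open>\<epsilon>(S\<^bsub>\<nu>\<^esub>) = 1\<close> for every partition \<open>\<nu>\<close>. The
theorem evaluates \<open>\<epsilon>(S\<^bsub>\<lambda>\<^esub> S\<^bsub>\<mu>\<^esub>)\<close>, and
it follows from two identities for skew Schur functions:

  (1) \<open>S\<^bsub>\<nu>/\<lambda>\<^esub> = \<Sum>\<^sub>\<mu> c(\<nu>; \<mu>, \<lambda>) S\<^bsub>\<mu>\<^esub>\<close>, where \<open>c(\<nu>; \<mu>, \<lambda>)\<close> is the coefficient of \<open>S\<^bsub>\<nu>\<^esub>\<close> in \<open>S\<^bsub>\<mu>\<^esub> S\<^bsub>\<lambda>\<^esub>\<close>;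

  (2) \<open>\<Sum>\<^sub>\<nu> S\<^bsub>\<nu>/\<lambda>\<^esub> = (\<Sum>\<^sub>\<beta> S\<^bsub>\<beta>\<^esub>) (\<Sum>\<^sub>\<nu> S\<^bsub>\<lambda>/\<nu>\<^esub>)\<close>.

Expanding both sides of (2) with (1) and comparing the coefficients of
\<open>S\<^bsub>\<mu>\<^esub>\<close> gives the theorem, up to the symmetry of \<open>c\<close> in
its two lower arguments.

Both identities are obtained without the Littlewood-Richardson rule or the RSK correspondence, from
one local fact about horizontal strips, \<open>raise_lower\<close>: the operators that add and that
remove a horizontal strip commute up to an explicit factor, because of a bijection that reflects
each row length in the interval in which it can vary. A tableau is a chain of horizontal strips
(\<open>schur_nth\<close>), so iterating this relation along a chain
(\<open>raise_fold_lower\<close>) yields Pieri's formula (\<open>pieri\<close>) and, starting from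
\<open>\<epsilon>\<close>, identity (2) (\<open>foldr_raise_ones\<close>).

The Schur functions are linearly independent and their products have Schur expansions by the same
induction (\<open>partition_induct\<close>): \<open>\<lambda>\<close> is the least dominant of the
partitions that arise when a strip of the size of the last row is added to \<open>\<lambda>\<close>
without that row. Identity (1) (\<open>skew_kostka\<close>) holds because both sides, as functions
of \<open>\<nu>\<close>, evolve in the same way when a strip is added; by linear independence this
comes down to computing the product \<open>h\<^sub>a S\<^bsub>\<tau>\<^esub>
S\<^bsub>\<mu>\<^esub>\<close> in two ways (\<open>raise_lr\<close>).

All computations are done with coefficients: an exponent vector is a list of natural numbers, a
series is a function on such lists, and only the last part translates the results to formal power
series.
\<close>

section \<open>Partitions as row-length functions\<close>

definition row :: "partition \<Rightarrow> nat \<Rightarrow> nat" where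
  "row la i = nth_default 0 (parts la) i"

definition psize :: "partition \<Rightarrow> nat" where
  "psize la = sum_list (parts la)"

definition empty_partition :: partition where
  "empty_partition = Abs_partition []"

definition of_rows :: "(nat \<Rightarrow> nat) \<Rightarrow> partition" where
  "of_rows f = (SOME la. row la = f)"

lemma row_eq_0_iff: "row la i = 0 \<longleftrightarrow> length (parts la) \<le> i"
proof -
  have "0 \<notin> set (parts la)" using parts[of la] by simp
  then show ?thesis by (metis row_def nth_default_def nth_mem not_le)
qed

lemma row_antimono: "i \<le> j \<Longrightarrow> row la j \<le> row la i"
proof -
  assume "i \<le> j"
  moreover have "sorted_wrt (\<ge>) (parts la)" using parts[of la] by simp
  ultimately show ?thesis
    by (cases "i = j") (auto simp: row_def nth_default_def sorted_wrt_iff_nth_less)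
qed

lemma partition_eqI:
  assumes "\<And>i. row la i = row mu i"
  shows "la = mu"
proof -
  have "length (parts la) \<le> i \<longleftrightarrow> length (parts mu) \<le> i" for i
    using assms row_eq_0_iff by metis
  then have "length (parts la) = length (parts mu)"
    by (metis le_antisym order_refl)
  moreover have "parts la ! i = parts mu ! i" if "i < length (parts la)" for i
    using assms[of i] that calculation by (simp add: row_def nth_default_def)
  ultimately have "parts la = parts mu" by (simp add: nth_equalityI)
  then show ?thesis by (simp add: parts_inject)
qed

lemma row_of_rows:
  assumes anti: "\<And>i. f (Suc i) \<le> f i" and zero: "f n = 0"
  shows "row (of_rows f) = f"
proof -
  have anti': "f j \<le> f i" if "i \<le> j" for i j
    using lift_Suc_antimono_le[of f, OF _ that] anti by blast
  define k where "k = (LEAST n. f n = 0)"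
  have k: "f k = 0" unfolding k_def using zero by (rule LeastI)
  have below: "f i \<noteq> 0" if "i < k" for i
    using that not_less_Least[of i "\<lambda>n. f n = 0"] by (auto simp: k_def)
  have above: "f i = 0" if "k \<le> i" for i
    using anti'[OF that] k by simp
  have "map f [0..<k] \<in> {xs. sorted_wrt (\<ge>) xs \<and> 0 \<notin> set xs}"
  proof -
    have "sorted_wrt (\<ge>) (map f [0..<k])"
      unfolding sorted_wrt_iff_nth_less by (auto intro: anti')
    moreover have "0 \<notin> set (map f [0..<k])"
    proof
      assume "0 \<in> set (map f [0..<k])"
      then obtain i where "i < k" "f i = 0" by auto
      with below[of i] show False by simp
    qed
    ultimately show ?thesis by simp
  qed
  then have "row (Abs_partition (map f [0..<k])) = f"
    by (auto simp: row_def fun_eq_iff Abs_partition_inverse nth_default_def above)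
  then show ?thesis unfolding of_rows_def by (rule someI)
qed

lemma row_empty [simp]: "row empty_partition i = 0"
  by (simp add: row_def empty_partition_def Abs_partition_inverse)

lemma psize_eq_sum_row:
  assumes "row la n = 0"
  shows "psize la = (\<Sum>i<n. row la i)"
proof -
  have le: "length (parts la) \<le> n" using assms by (simp add: row_eq_0_iff)
  have "psize la = (\<Sum>i<length (parts la). parts la ! i)"
    by (simp add: psize_def sum_list_sum_nth atLeast0LessThan)
  also have "\<dots> = (\<Sum>i<length (parts la). row la i)"
    by (intro sum.cong) (auto simp: row_def nth_default_def)
  also have "\<dots> = (\<Sum>i<n. row la i)"
    by (rule sum.mono_neutral_left) (use le in \<open>auto simp: row_eq_0_iff\<close>)
  finally show ?thesis .
qed

lemma ex_row_zero: "\<exists>n. row la n = 0"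
  using row_eq_0_iff by blast

lemma row_zero_mono: "row la n = 0 \<Longrightarrow> n \<le> m \<Longrightarrow> row la m = 0"
  by (simp add: row_eq_0_iff)

lemma psize_empty [simp]: "psize empty_partition = 0"
  using psize_eq_sum_row[of empty_partition 0] by simp

lemma psize_eq_0_iff: "psize la = 0 \<longleftrightarrow> la = empty_partition"
proof
  assume "psize la = 0"
  then have z: "\<forall>x \<in> set (parts la). x = 0" by (simp add: psize_def)
  have "row la i = 0" for i
    using z by (simp add: row_def nth_default_def)
  then show "la = empty_partition" by (intro partition_eqI) simp
qed simp

lemma finite_psize_eq [simp]: "finite {la. psize la = d}"
proof -
  have "length xs \<le> sum_list xs" if "0 \<notin> set xs" for xs :: "nat list"
    using that by (induction xs) auto
  then have "parts ` {la. psize la = d} \<subseteq> {xs. set xs \<subseteq> {..d} \<and> length xs \<le> d}"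
    using parts by (auto simp: psize_def member_le_sum_list)
  then have "finite (parts ` {la. psize la = d})"
    by (rule finite_subset) (rule finite_lists_length_le, simp)
  then show ?thesis
    by (rule finite_imageD) (auto simp: inj_on_def parts_inject)
qed

lemma finite_psize_le [simp]: "finite {la. psize la \<le> d}"
proof -
  have "{la. psize la \<le> d} = (\<Union>e\<le>d. {la. psize la = e})" by auto
  then show ?thesis by simp
qed

section \<open>Horizontal strips and their reflection\<close>

text \<open>
The interlacing condition says that the skew diagram \<open>la / ta\<close> has at most one box in
each column.
\<close>

definition hstrip :: "partition \<Rightarrow> partition \<Rightarrow> bool" where
  "hstrip ta la \<longleftrightarrow> (\<forall>i. row la (Suc i) \<le> row ta i \<and> row ta i \<le> row la i)"

definition up :: "partition \<Rightarrow> nat \<Rightarrow> partition set" where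
  "up la a = {rh. hstrip la rh \<and> psize rh = psize la + a}"

definition down :: "partition \<Rightarrow> nat \<Rightarrow> partition set" where
  "down la a = {ta. hstrip ta la \<and> psize la = psize ta + a}"

lemma finite_up [simp]: "finite (up la a)"
  by (rule finite_subset[OF _ finite_psize_eq[of "psize la + a"]]) (auto simp: up_def)

lemma finite_down [simp]: "finite (down la a)"
  by (rule finite_subset[OF _ finite_psize_le[of "psize la"]]) (auto simp: down_def)

lemma in_up_iff_in_down: "rh \<in> up la a \<longleftrightarrow> la \<in> down rh a"
  by (auto simp: up_def down_def)

lemma hstrip_psize_le:
  assumes "hstrip ta la"
  shows "psize ta \<le> psize la"
proof -
  obtain n where "row la n = 0" using ex_row_zero by blast
  moreover from this have "row ta n = 0" using assms by (metis hstrip_def le_zero_eq)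
  ultimately show ?thesis using assms by (simp add: psize_eq_sum_row[of _ n] hstrip_def sum_mono)
qed

lemma hstrip_psize_eq:
  assumes h: "hstrip ta la" and size: "psize ta = psize la"
  shows "ta = la"
proof (rule partition_eqI)
  fix i
  have le: "row ta j \<le> row la j" for j using h by (simp add: hstrip_def)
  obtain n where n: "row la n = 0" using ex_row_zero by blast
  define m where "m = max n (Suc i)"
  have z: "row la m = 0" using row_zero_mono[OF n] by (simp add: m_def)
  then have "row ta m = 0" using le[of m] by simp
  with z size have eq: "(\<Sum>i<m. row ta i) = (\<Sum>i<m. row la i)"
    by (simp add: psize_eq_sum_row[symmetric])
  show "row ta i = row la i"
  proof (rule ccontr)
    assume "row ta i \<noteq> row la i"
    with le[of i] have "row ta i < row la i" by simp
    then have "(\<Sum>i<m. row ta i) < (\<Sum>i<m. row la i)"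
      by (intro sum_strict_mono_ex1) (auto simp: le m_def)
    with eq show False by simp
  qed
qed

lemma up_0: "up mu 0 = {mu}"
proof -
  have "hstrip mu mu" by (simp add: hstrip_def row_antimono)
  then show ?thesis by (auto simp: up_def dest: hstrip_psize_eq)
qed

text \<open>
Fix \<open>la\<close> and \<open>mu\<close>. A partition \<open>rh\<close> contains both with
horizontal strips as differences iff row \<open>i + 1\<close> of \<open>rh\<close> lies between
\<open>max (row la (i + 1)) (row mu (i + 1))\<close> and \<open>min (row la i) (row mu i)\<close>,
and row 0 is at least \<open>max (row la 0) (row mu 0)\<close>. A partition \<open>ta\<close> is
contained in both in this way iff its row \<open>i\<close> lies in that same interval. Reflecting
each interval at its midpoint therefore turns \<open>rh\<close> into \<open>ta\<close>; the only
datum of \<open>rh\<close> that is lost is the excess \<open>k\<close> of its row 0. The reflection,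
rather than the mere index shift, is what makes the sizes of the strips correspond.
\<close>

definition reflect_down :: "partition \<Rightarrow> partition \<Rightarrow> partition \<Rightarrow> partition" where
  "reflect_down la mu rh =
    of_rows (\<lambda>i. max (row la (Suc i)) (row mu (Suc i)) + min (row la i) (row mu i) - row rh (Suc i))"

definition reflect_up :: "partition \<Rightarrow> partition \<Rightarrow> nat \<Rightarrow> partition \<Rightarrow> partition" where
  "reflect_up la mu k ta =
    of_rows (\<lambda>i. case i of 0 \<Rightarrow> max (row la 0) (row mu 0) + k
      | Suc i \<Rightarrow> max (row la (Suc i)) (row mu (Suc i)) + min (row la i) (row mu i) - row ta i)"

lemma row_reflect_down:
  assumes "hstrip la rh" "hstrip mu rh"
  shows "row (reflect_down la mu rh) i =
    max (row la (Suc i)) (row mu (Suc i)) + min (row la i) (row mu i) - row rh (Suc i)"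
proof -
  let ?f = "\<lambda>i. max (row la (Suc i)) (row mu (Suc i)) + min (row la i) (row mu i) - row rh (Suc i)"
  obtain n where n: "row la n = 0" using ex_row_zero by blast
  obtain n' where n': "row mu n' = 0" using ex_row_zero by blast
  have "?f (n + n') = 0"
    using row_zero_mono[OF n, of "n + n'"] row_zero_mono[OF n, of "Suc (n + n')"]
      row_zero_mono[OF n', of "n + n'"] row_zero_mono[OF n', of "Suc (n + n')"] by simp
  moreover have "?f (Suc i) \<le> ?f i" for i
  proof -
    have "row rh (Suc i) \<le> row la i" "row rh (Suc i) \<le> row mu i" "row la (Suc i) \<le> row rh (Suc i)"
      "row mu (Suc i) \<le> row rh (Suc i)" "row la (Suc (Suc i)) \<le> row rh (Suc (Suc i))"
      "row mu (Suc (Suc i)) \<le> row rh (Suc (Suc i))"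
      using assms by (auto simp: hstrip_def)
    then show ?thesis by linarith
  qed
  ultimately show ?thesis
    unfolding reflect_down_def by (subst row_of_rows) auto
qed

lemma row_reflect_up:
  assumes "hstrip ta la" "hstrip ta mu"
  shows "row (reflect_up la mu k ta) i = (case i of 0 \<Rightarrow> max (row la 0) (row mu 0) + k
      | Suc i \<Rightarrow> max (row la (Suc i)) (row mu (Suc i)) + min (row la i) (row mu i) - row ta i)"
proof -
  let ?f = "\<lambda>i. case i of 0 \<Rightarrow> max (row la 0) (row mu 0) + k
      | Suc i \<Rightarrow> max (row la (Suc i)) (row mu (Suc i)) + min (row la i) (row mu i) - row ta i"
  obtain n where n: "row la n = 0" using ex_row_zero by blast
  obtain n' where n': "row mu n' = 0" using ex_row_zero by blast
  have "?f (Suc (n + n')) = 0"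
    using row_zero_mono[OF n, of "n + n'"] row_zero_mono[OF n, of "Suc (n + n')"]
      row_zero_mono[OF n', of "n + n'"] row_zero_mono[OF n', of "Suc (n + n')"] by simp
  moreover have "?f (Suc i) \<le> ?f i" for i
  proof -
    have b: "row la (Suc i) \<le> row ta i" "row mu (Suc i) \<le> row ta i" "row ta i \<le> row la i"
      "row ta i \<le> row mu i" for i
      using assms by (auto simp: hstrip_def)
    show ?thesis
    proof (cases i)
      case 0
      then show ?thesis using b[of 0] by simp
    next
      case (Suc j)
      then show ?thesis using b[of "Suc j"] b[of j] by simp
    qed
  qed
  ultimately show ?thesis
    unfolding reflect_up_def by (subst row_of_rows[where n = "Suc (n + n')"]) auto
qed

text \<open>
The reflection trades the size of \<open>rh\<close> against that of \<open>ta\<close>: summed over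
all rows, the interval bounds add up to the rows of \<open>la\<close> and \<open>mu\<close>, except
for the bound on row 0.
\<close>

lemma psize_reflect:
  assumes sum: "\<And>i. row ta i + row rh (Suc i) =
      max (row la (Suc i)) (row mu (Suc i)) + min (row la i) (row mu i)"
    and top: "row rh 0 = max (row la 0) (row mu 0) + k"
  shows "psize ta + psize rh = psize la + psize mu + k"
proof -
  obtain n1 n2 n3 n4 where z: "row la n1 = 0" "row mu n2 = 0" "row ta n3 = 0" "row rh n4 = 0"
    using ex_row_zero by metis
  define n where "n = n1 + n2 + n3 + n4"
  note z' = z[THEN row_zero_mono]
  let ?M = "\<lambda>i. max (row la i) (row mu i)" and ?m = "\<lambda>i. min (row la i) (row mu i)"
  have "psize ta + psize rh = (\<Sum>i<n. row ta i) + (\<Sum>i<Suc n. row rh i)"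
    using z' by (simp add: psize_eq_sum_row[of ta n] psize_eq_sum_row[of rh "Suc n"] n_def
        del: sum.lessThan_Suc)
  also have "\<dots> = (\<Sum>i<n. row ta i + row rh (Suc i)) + row rh 0"
    by (simp add: sum.lessThan_Suc_shift sum.distrib del: sum.lessThan_Suc)
  also have "\<dots> = (\<Sum>i<Suc n. ?M i) + (\<Sum>i<n. ?m i) + k"
    by (simp add: sum top sum.distrib sum.lessThan_Suc_shift del: sum.lessThan_Suc)
  also have "\<dots> = (\<Sum>i<n. ?M i + ?m i) + k"
    using z' by (simp add: sum.distrib n_def)
  also have "(\<Sum>i<n. ?M i + ?m i) = (\<Sum>i<n. row la i + row mu i)"
    by (intro sum.cong) auto
  also have "\<dots> = psize la + psize mu"
    using z' by (simp add: psize_eq_sum_row[of _ n] n_def sum.distrib)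
  finally show ?thesis .
qed

lemma reflect_down_props:
  fixes la mu rh
  defines "k \<equiv> row rh 0 - max (row la 0) (row mu 0)" and "ta \<equiv> reflect_down la mu rh"
  assumes "hstrip la rh" "hstrip mu rh"
  shows "hstrip ta la" "hstrip ta mu" "reflect_up la mu k ta = rh"
    "psize ta + psize rh = psize la + psize mu + k"
proof -
  have b: "row rh (Suc i) \<le> row la i" "row rh (Suc i) \<le> row mu i" "row la i \<le> row rh i"
      "row mu i \<le> row rh i" for i
      using assms(3,4) by (auto simp: hstrip_def)
  have r: "row ta i = max (row la (Suc i)) (row mu (Suc i)) + min (row la i) (row mu i) - row rh (Suc i)" for i
    unfolding ta_def using assms(3,4) by (rule row_reflect_down)
  have "row la (Suc i) \<le> row ta i" "row mu (Suc i) \<le> row ta i" "row ta i \<le> row la i"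
      "row ta i \<le> row mu i" for i
    unfolding r using b[of i] b[of "Suc i"] by linarith+
  then show h: "hstrip ta la" "hstrip ta mu" by (auto simp: hstrip_def)
  show "reflect_up la mu k ta = rh"
  proof (rule partition_eqI)
    fix i
    show "row (reflect_up la mu k ta) i = row rh i"
      unfolding row_reflect_up[OF h]
      by (cases i) (use b[of 0] b[of "i - 1"] b[of i] in \<open>auto simp: k_def r\<close>)
  qed
  show "psize ta + psize rh = psize la + psize mu + k"
  proof (rule psize_reflect)
    fix i
    show "row ta i + row rh (Suc i) = max (row la (Suc i)) (row mu (Suc i)) + min (row la i) (row mu i)"
      unfolding r using b[of i] b[of "Suc i"] by linarith
    show "row rh 0 = max (row la 0) (row mu 0) + k"
      using b[of 0] by (simp add: k_def)
  qed
qed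

lemma reflect_up_props:
  fixes la mu ta k
  defines "rh \<equiv> reflect_up la mu k ta"
  assumes "hstrip ta la" "hstrip ta mu"
  shows "hstrip la rh" "hstrip mu rh" "reflect_down la mu rh = ta"
    "row rh 0 - max (row la 0) (row mu 0) = k"
    "psize ta + psize rh = psize la + psize mu + k"
proof -
  have b: "row la (Suc i) \<le> row ta i" "row mu (Suc i) \<le> row ta i" "row ta i \<le> row la i"
      "row ta i \<le> row mu i" for i
      using assms(2,3) by (auto simp: hstrip_def)
  have r0: "row rh 0 = max (row la 0) (row mu 0) + k"
    and r: "row rh (Suc i) = max (row la (Suc i)) (row mu (Suc i)) + min (row la i) (row mu i) - row ta i" for i
    unfolding rh_def using row_reflect_up[OF assms(2,3)] by simp_all
  have "row rh (Suc i) \<le> row la i \<and> row rh (Suc i) \<le> row mu i" for i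
    unfolding r using b[of i] b[of "Suc i"] by linarith
  moreover have "row la i \<le> row rh i \<and> row mu i \<le> row rh i" for i
    by (cases i) (use b[of "i - 1"] in \<open>auto simp: r r0\<close>)
  ultimately show h: "hstrip la rh" "hstrip mu rh" by (auto simp: hstrip_def)
  show "reflect_down la mu rh = ta"
  proof (rule partition_eqI)
    fix i
    show "row (reflect_down la mu rh) i = row ta i"
      unfolding row_reflect_down[OF h] r using b[of i] b[of "Suc i"] by linarith
  qed
  show "row rh 0 - max (row la 0) (row mu 0) = k" by (simp add: r0)
  show "psize ta + psize rh = psize la + psize mu + k"
  proof (rule psize_reflect)
    fix i
    show "row ta i + row rh (Suc i) = max (row la (Suc i)) (row mu (Suc i)) + min (row la i) (row mu i)"
      unfolding r using b[of i] b[of "Suc i"] by linarith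
  qed (rule r0)
qed

section \<open>Adding and removing horizontal strips\<close>

text \<open>
A function \<open>g\<close> on partitions is read as the linear functional that takes
\<open>S\<^bsub>\<lambda>\<^esub>\<close> to \<open>g \<lambda>\<close>. Then \<open>raise a
g\<close> is its composition with the multiplication by the complete symmetric function
\<open>h\<^sub>a\<close>, and \<open>lower a g\<close> its composition with the adjoint of that
multiplication. Working with functionals instead of formal sums of partitions keeps every sum
finite, even for the functional that is 1 on all partitions.
\<close>

definition raise :: "nat \<Rightarrow> (partition \<Rightarrow> int) \<Rightarrow> partition \<Rightarrow> int" where
  "raise a g la = (\<Sum>rh \<in> up la a. g rh)"

definition lower :: "nat \<Rightarrow> (partition \<Rightarrow> int) \<Rightarrow> partition \<Rightarrow> int" where
  "lower a g la = (\<Sum>ta \<in> down la a. g ta)"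

text \<open>
This is the commutation relation that drives the whole proof. If \<open>U(x)\<close> and
\<open>D(y)\<close> are the generating functions of the operators on symmetric functions that add
and remove strips, it reads \<open>(1 - x y) D(y) U(x) = U(x) D(y)\<close>. The sum over
\<open>k\<close> is the geometric series of \<open>x y\<close>: each box of excess in row 0 belongs
to both strips.
\<close>

lemma raise_lower:
  "raise a (lower b g) mu = (\<Sum>k\<le>min a b. lower (b - k) (raise (a - k) g) mu)"
proof -
  let ?S = "Sigma (up mu a) (\<lambda>rh. down rh b)"
  let ?R = "Sigma {..min a b} (\<lambda>k. Sigma (down mu (b - k)) (\<lambda>ta. up ta (a - k)))"
  have "raise a (lower b g) mu = (\<Sum>(rh, la) \<in> ?S. g la)"
    by (simp add: raise_def lower_def sum.Sigma)
  also have "\<dots> = (\<Sum>(k, ta, la) \<in> ?R. g la)"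
  proof (rule sum.reindex_bij_witness[where
        i = "\<lambda>(k, ta, la). (reflect_up la mu k ta, la)" and
        j = "\<lambda>(rh, la). (row rh 0 - max (row la 0) (row mu 0), reflect_down la mu rh, la)"])
    fix p assume "p \<in> ?S"
    then obtain rh la where p: "p = (rh, la)" "hstrip mu rh" "psize rh = psize mu + a"
      "hstrip la rh" "psize rh = psize la + b" by (auto simp: up_def down_def)
    note q = reflect_down_props[OF p(4,2)]
    have "psize (reflect_down la mu rh) \<le> psize la" "psize (reflect_down la mu rh) \<le> psize mu"
      using hstrip_psize_le q by auto
    then show "(case p of (rh, la) \<Rightarrow> (row rh 0 - max (row la 0) (row mu 0), reflect_down la mu rh, la)) \<in> ?R"
      using q p by (auto simp: up_def down_def)
    show "(case case p of (rh, la) \<Rightarrow> (row rh 0 - max (row la 0) (row mu 0), reflect_down la mu rh, la)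
      of (k, ta, la) \<Rightarrow> (reflect_up la mu k ta, la)) = p"
      using q p by simp
  next
    fix p assume "p \<in> ?R"
    then obtain k ta la where p: "p = (k, ta, la)" "k \<le> a" "k \<le> b" "hstrip ta mu" "psize mu = psize ta + (b - k)"
      "hstrip ta la" "psize la = psize ta + (a - k)" by (auto simp: up_def down_def)
    note q = reflect_up_props[OF p(6,4)]
    show "(case p of (k, ta, la) \<Rightarrow> (reflect_up la mu k ta, la)) \<in> ?S"
      using q(1,2) q(5)[of k] p by (auto simp: up_def down_def)
    show "(case case p of (k, ta, la) \<Rightarrow> (reflect_up la mu k ta, la) of
      (rh, la) \<Rightarrow> (row rh 0 - max (row la 0) (row mu 0), reflect_down la mu rh, la)) = p"
      using q p by simp
  qed auto
  also have "\<dots> = (\<Sum>k\<le>min a b. lower (b - k) (raise (a - k) g) mu)"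
    by (simp add: raise_def lower_def sum.Sigma)
  finally show ?thesis .
qed

definition delta :: "partition \<Rightarrow> partition \<Rightarrow> int" where
  "delta mu la = (if la = mu then 1 else 0)"

lemma sum_delta: "finite A \<Longrightarrow> (\<Sum>nu\<in>A. delta mu nu * f nu) = (if mu \<in> A then f mu else 0)"
proof -
  assume "finite A"
  moreover have "delta mu nu * f nu = (if nu = mu then f nu else 0)" for nu
    by (simp add: delta_def)
  ultimately show ?thesis by simp
qed

lemma raise_delta_empty: "raise a (delta empty_partition) = (if a = 0 then delta empty_partition else (\<lambda>_. 0))"
proof
  fix la
  have "empty_partition \<in> up la a \<longleftrightarrow> a = 0 \<and> la = empty_partition"
    by (auto simp: up_def hstrip_def psize_eq_0_iff)
  then show "raise a (delta empty_partition) la = (if a = 0 then delta empty_partition else (\<lambda>_. 0)) la"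
    by (auto simp: raise_def delta_def sum.delta)
qed

lemma lower_empty: "lower a g empty_partition = (if a = 0 then g empty_partition else 0)"
proof -
  have "down empty_partition a = (if a = 0 then {empty_partition} else {})"
    by (auto simp: down_def hstrip_def psize_eq_0_iff)
  then show ?thesis by (simp add: lower_def)
qed

text \<open>
Adding and removing strips is equally plentiful, apart from the unbounded row 0. This is the
commutation relation with both strips of size \<open>a\<close>, paired with the point mass at
\<open>la\<close>: the reflection then matches the strips above \<open>la\<close> with those below
it.
\<close>

lemma raise_one: "raise a (\<lambda>_. 1) la = (\<Sum>l\<le>a. lower l (\<lambda>_. 1) la)"
proof -
  have pick: "(\<Sum>nu\<in>A. delta la nu) = (if la \<in> A then 1 else 0)" if "finite A" for A
    unfolding delta_def using that by (simp add: sum.delta)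
  \<comment> \<open>On the point mass at \<open>la\<close>, both sides of the commutation relation count returns to \<open>la\<close>.\<close>
  have "raise a (lower a (delta la)) la = (\<Sum>rh\<in>up la a. 1)"
    unfolding raise_def lower_def
    by (intro sum.cong) (auto simp: pick in_up_iff_in_down)
  moreover have "lower (a - k) (raise (a - k) (delta la)) la = (\<Sum>ta\<in>down la (a - k). 1)" for k
    unfolding raise_def lower_def
    by (intro sum.cong) (auto simp: pick in_up_iff_in_down)
  ultimately have "raise a (\<lambda>_. 1) la = (\<Sum>k\<le>a. lower (a - k) (\<lambda>_. 1) la)"
    using raise_lower[of a a "delta la" la] by (simp add: raise_def lower_def)
  also have "\<dots> = (\<Sum>l\<le>a. lower l (\<lambda>_. 1) la)"
    by (rule sum.reindex_bij_witness[where i = "\<lambda>l. a - l" and j = "\<lambda>l. a - l"]) auto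
  finally show ?thesis .
qed

lemma lower_sum: "lower a (\<lambda>x. \<Sum>i\<in>I. c i * g i x) = (\<lambda>x. \<Sum>i\<in>I. c i * lower a (g i) x)"
  by (simp add: lower_def fun_eq_iff sum_distrib_left sum.swap[of _ I])

lemma raise_sum: "raise a (\<lambda>x. \<Sum>i\<in>I. c i * g i x) = (\<lambda>x. \<Sum>i\<in>I. c i * raise a (g i) x)"
  by (simp add: raise_def fun_eq_iff sum_distrib_left sum.swap[of _ I])

lemma fold_lower_sum:
  "fold lower ka (\<lambda>x. \<Sum>i\<in>I. c i * g i x) = (\<lambda>x. \<Sum>i\<in>I. c i * fold lower ka (g i) x)"
  by (induction ka arbitrary: g) (simp_all add: lower_sum)

lemma fold_lower_sum_1: "fold lower ka (\<lambda>x. \<Sum>i\<in>I. g i x) = (\<lambda>x. \<Sum>i\<in>I. fold lower ka (g i) x)"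
  using fold_lower_sum[where c = "\<lambda>_. 1"] by simp

lemma fold_lower_diff:
  "fold lower ka (\<lambda>x. f x - g x) = (\<lambda>x. fold lower ka f x - fold lower ka g x)"
proof -
  have "lower a (\<lambda>x. f x - g x) = (\<lambda>x. lower a f x - lower a g x)" for a f g
    by (simp add: lower_def fun_eq_iff sum_subtractf)
  then show ?thesis by (induction ka arbitrary: f g) simp_all
qed

lemma fold_lower_empty:
  "fold lower ka g empty_partition = (if sum_list ka = 0 then g empty_partition else 0)"
  by (induction ka arbitrary: g) (auto simp: lower_empty)

lemma raise_adjoint:
  "(\<Sum>ta | psize ta = d. c ta * raise a g ta) = (\<Sum>la | psize la = d + a. lower a c la * g la)"
proof -
  have "(\<Sum>ta | psize ta = d. c ta * raise a g ta) =
     (\<Sum>(ta, la) \<in> Sigma {ta. psize ta = d} (\<lambda>ta. up ta a). c ta * g la)"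
    by (simp add: raise_def sum_distrib_left sum.Sigma)
  also have "\<dots> = (\<Sum>(la, ta) \<in> Sigma {la. psize la = d + a} (\<lambda>la. down la a). c ta * g la)"
    by (rule sum.reindex_bij_witness[where i = prod.swap and j = prod.swap])
       (auto simp: up_def down_def)
  also have "\<dots> = (\<Sum>la | psize la = d + a. lower a c la * g la)"
    by (simp add: lower_def sum_distrib_right sum.Sigma)
  finally show ?thesis .
qed

lemma foldr_raise_adjoint:
  "(\<Sum>ta | psize ta = d. c ta * foldr raise ka g ta) =
    (\<Sum>la | psize la = d + sum_list ka. fold lower ka c la * g la)"
  by (induction ka arbitrary: c d) (simp_all add: raise_adjoint add.assoc)

section \<open>Convolution over exponent vectors\<close>

text \<open>
The pairs of vectors with the sum \<open>ka\<close>, as a recursion over the entries so that sums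
over them can be unfolded one variable at a time.
\<close>

primrec splits :: "nat list \<Rightarrow> (nat list \<times> nat list) set" where
  "splits [] = {([], [])}"
| "splits (b # ka) = (\<lambda>(k, x, y). (k # x, (b - k) # y)) ` ({..b} \<times> splits ka)"

lemma finite_splits [simp]: "finite (splits ka)"
  by (induction ka) auto

lemma splits_iff: "(x, y) \<in> splits ka \<longleftrightarrow> length x = length y \<and> map2 (+) x y = ka"
proof (induction ka arbitrary: x y)
  case Nil
  then show ?case by auto
next
  case (Cons b ka)
  have "(x, y) \<in> splits (b # ka) \<longleftrightarrow>
    (\<exists>k x' y'. x = k # x' \<and> y = (b - k) # y' \<and> k \<le> b \<and> (x', y') \<in> splits ka)"
    by (simp add: image_iff Bex_def case_prod_unfold) auto
  also have "\<dots> \<longleftrightarrow> length x = length y \<and> map2 (+) x y = b # ka"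
    unfolding Cons.IH by (cases x; cases y) auto
  finally show ?case .
qed

lemma sum_splits_Cons:
  "(\<Sum>(x, y) \<in> splits (b # ka). f x y) = (\<Sum>k\<le>b. \<Sum>(x, y) \<in> splits ka. f (k # x) ((b - k) # y))"
proof -
  have "inj_on (\<lambda>(k, x, y). (k # x, (b - k) # y)) ({..b} \<times> splits ka)"
    by (auto simp: inj_on_def)
  then have "(\<Sum>(x, y) \<in> splits (b # ka). f x y) =
      (\<Sum>(k, x, y) \<in> {..b} \<times> splits ka. f (k # x) ((b - k) # y))"
    by (simp add: sum.reindex case_prod_unfold)
  also have "\<dots> = (\<Sum>k\<le>b. \<Sum>(x, y) \<in> splits ka. f (k # x) ((b - k) # y))"
    by (simp add: sum.cartesian_product case_prod_unfold)
  finally show ?thesis .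
qed

lemma sum_list_splits: "(x, y) \<in> splits ka \<Longrightarrow> sum_list x + sum_list y = sum_list ka"
  by (induction ka arbitrary: x y) fastforce+

lemma sum_splits_commute: "(\<Sum>(x, y) \<in> splits ka. f x y) = (\<Sum>(x, y) \<in> splits ka. f y x)"
proof (rule sum.reindex_bij_witness[where i = prod.swap and j = prod.swap])
  have sw: "(y, x) \<in> splits ka" if "(x, y) \<in> splits ka" for x y
  proof -
    have "map2 (+) y x = map2 (+) x y" by (rule nth_equalityI) auto
    with that show ?thesis by (simp add: splits_iff)
  qed
  show "prod.swap p \<in> splits ka" "prod.swap p \<in> splits ka" if "p \<in> splits ka" for p
    using sw that by (cases p; simp)+
qed auto

lemma sum_splits_zero: "(\<Sum>(x, y) \<in> splits ka. if sum_list y = 0 then f x else 0) = f ka"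
proof (induction ka arbitrary: f)
  case Nil
  then show ?case by simp
next
  case (Cons b ka)
  have "(\<Sum>(x, y) \<in> splits ka. if sum_list ((b - k) # y) = 0 then f (k # x) else 0) =
      (if k = b then f (b # ka) else 0)" if "k \<le> b" for k
  proof (cases "k = b")
    case True
    show ?thesis unfolding True using Cons.IH[of "\<lambda>x. f (b # x)"] by simp
  next
    case False
    with that have "\<not> b \<le> k" by simp
    then show ?thesis using False by simp
  qed
  then have "(\<Sum>(x, y) \<in> splits (b # ka). if sum_list y = 0 then f x else 0) =
      (\<Sum>k\<le>b. if k = b then f (b # ka) else 0)"
    unfolding sum_splits_Cons by (intro sum.cong) auto
  then show ?case by simp
qed

lemma sum_splits_assoc:
  "(\<Sum>(x, w) \<in> splits ka. \<Sum>(y, z) \<in> splits w. f x y z) =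
   (\<Sum>(v, z) \<in> splits ka. \<Sum>(x, y) \<in> splits v. f x y z)"
proof -
  have as: "map2 (+) (map2 (+) x y) z = map2 (+) x (map2 (+) y z)"
    if "length x = length y" "length y = length z" for x y z :: "nat list"
    using that by (induction x y z rule: list_induct3) auto
  have l: "(map2 (+) x y, z) \<in> splits ka \<and> (x, y) \<in> splits (map2 (+) x y) \<and> map2 (+) y z = w"
    if "(x, w) \<in> splits ka" "(y, z) \<in> splits w" for x w y z
  proof -
    have len: "length y = length z" "length x = length y" and eq: "map2 (+) x w = ka" "map2 (+) y z = w"
      using that by (auto simp: splits_iff)
    then show ?thesis using as[of x y z] by (simp add: splits_iff)
  qed
  have r: "(x, map2 (+) y z) \<in> splits ka \<and> (y, z) \<in> splits (map2 (+) y z) \<and> map2 (+) x y = v"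
    if "(v, z) \<in> splits ka" "(x, y) \<in> splits v" for v z x y
  proof -
    have len: "length y = length z" "length x = length y" and eq: "map2 (+) v z = ka" "map2 (+) x y = v"
      using that by (auto simp: splits_iff)
    then show ?thesis using as[of x y z] by (simp add: splits_iff)
  qed
  have "(\<Sum>(x, w) \<in> splits ka. \<Sum>(y, z) \<in> splits w. f x y z) =
    (\<Sum>((x, w), (y, z)) \<in> Sigma (splits ka) (\<lambda>p. splits (snd p)). f x y z)"
    by (simp add: sum.Sigma case_prod_unfold)
  also have "\<dots> = (\<Sum>((v, z), (x, y)) \<in> Sigma (splits ka) (\<lambda>p. splits (fst p)). f x y z)"
    by (rule sum.reindex_bij_witness[where
       i = "\<lambda>((v, z), (x, y)). ((x, map2 (+) y z), (y, z))" and
       j = "\<lambda>((x, w), (y, z)). ((map2 (+) x y, z), (x, y))"])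
      (clarsimp; use l r in blast)+
  also have "\<dots> = (\<Sum>(v, z) \<in> splits ka. \<Sum>(x, y) \<in> splits v. f x y z)"
    by (simp add: sum.Sigma case_prod_unfold)
  finally show ?thesis .
qed

definition conv :: "(nat list \<Rightarrow> int) \<Rightarrow> (nat list \<Rightarrow> int) \<Rightarrow> nat list \<Rightarrow> int" where
  "conv f g ka = (\<Sum>(x, y) \<in> splits ka. f x * g y)"

lemma conv_commute: "conv f g = conv g f"
  unfolding conv_def by (subst sum_splits_commute) (simp add: mult.commute)

lemma conv_assoc: "conv f (conv g h) = conv (conv f g) h"
proof
  fix ka
  have "conv f (conv g h) ka = (\<Sum>(x, w) \<in> splits ka. \<Sum>(y, z) \<in> splits w. f x * (g y * h z))"
    by (simp add: conv_def sum_distrib_left case_prod_unfold)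
  also have "\<dots> = (\<Sum>(v, z) \<in> splits ka. \<Sum>(x, y) \<in> splits v. f x * (g y * h z))"
    by (rule sum_splits_assoc)
  also have "\<dots> = conv (conv f g) h ka"
    by (simp add: conv_def sum_distrib_right case_prod_unfold mult.assoc)
  finally show "conv f (conv g h) ka = conv (conv f g) h ka" .
qed

lemma conv_sum_right: "conv f (\<lambda>x. \<Sum>i\<in>I. c i * g i x) ka = (\<Sum>i\<in>I. c i * conv f (g i) ka)"
  unfolding conv_def
  by (simp add: sum_distrib_left case_prod_unfold mult.left_commute) (rule sum.swap)

lemma conv_sum_left: "conv (\<lambda>x. \<Sum>i\<in>I. c i * f i x) g ka = (\<Sum>i\<in>I. c i * conv (f i) g ka)"
  unfolding conv_commute[of _ g] by (rule conv_sum_right)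

section \<open>Commuting past a chain of strips and the Pieri formula\<close>

text \<open>
The iterated commutation relation. Adding one strip commutes past a chain of removals at the cost of
the factor \<open>\<Prod>\<^sub>i 1 / (1 - x y\<^sub>i)\<close>. The vector \<open>x\<close> in the
sum collects the excesses \<open>k\<close> of \<open>raise_lower\<close>, one for each strip of the
chain.
\<close>

lemma raise_fold_lower:
  "raise a (fold lower ka g) mu =
    (\<Sum>(x, y) \<in> splits ka. if sum_list x \<le> a then fold lower y (raise (a - sum_list x) g) mu else 0)"
proof (induction ka arbitrary: g)
  case Nil
  then show ?case by simp
next
  case (Cons b ka)
  let ?t = "\<lambda>k x y. if k + sum_list x \<le> a then fold lower y (lower (b - k) (raise (a - (k + sum_list x)) g)) mu else 0"
  have inner: "(if sum_list x \<le> a then fold lower y (raise (a - sum_list x) (lower b g)) mu else 0) =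
     (\<Sum>k\<le>b. ?t k x y)" for x y
  proof (cases "sum_list x \<le> a")
    case True
    let ?A = "a - sum_list x"
    have "raise ?A (lower b g) = (\<lambda>mu. \<Sum>k\<le>min ?A b. lower (b - k) (raise (?A - k) g) mu)"
      by (rule ext) (rule raise_lower)
    then have "fold lower y (raise ?A (lower b g)) mu =
       (\<Sum>k\<le>min ?A b. fold lower y (lower (b - k) (raise (?A - k) g)) mu)"
      by (simp add: fold_lower_sum_1)
    also have "\<dots> = (\<Sum>k\<le>b. ?t k x y)"
      using True by (intro sum.mono_neutral_cong_left) (auto simp: add.commute)
    finally show ?thesis using True by simp
  next
    case False
    then show ?thesis by simp
  qed
  have "raise a (fold lower (b # ka) g) mu = (\<Sum>(x, y) \<in> splits ka. \<Sum>k\<le>b. ?t k x y)"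
    by (simp add: Cons.IH inner)
  also have "\<dots> = (\<Sum>k\<le>b. \<Sum>(x, y) \<in> splits ka. ?t k x y)"
    by (simp add: case_prod_unfold) (rule sum.swap)
  also have "\<dots> = (\<Sum>(x, y) \<in> splits (b # ka).
      if sum_list x \<le> a then fold lower y (raise (a - sum_list x) g) mu else 0)"
    unfolding sum_splits_Cons by (simp add: case_prod_unfold cong: if_cong)
  finally show ?case .
qed

text \<open>
The number of chains of horizontal strips from the empty partition to \<open>la\<close> with strip
sizes \<open>ka\<close>. These are the Kostka numbers, so \<open>kostka la\<close> is the Schur
function of \<open>la\<close>, given by its coefficients. Replacing the empty partition by
\<open>mu\<close> gives the skew Schur function of shape \<open>la / mu\<close>.
\<close>

definition kostka :: "partition \<Rightarrow> nat list \<Rightarrow> int" where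
  "kostka la ka = fold lower ka (delta empty_partition) la"

text \<open>
The complete homogeneous symmetric function \<open>h\<^sub>a\<close>.
\<close>

definition complete :: "nat \<Rightarrow> nat list \<Rightarrow> int" where
  "complete a ka = (if sum_list ka = a then 1 else 0)"

lemma fold_lower_zero: "fold lower ka (\<lambda>_. 0) = (\<lambda>_. 0)"
  using fold_lower_sum_1[where I = "{}"] by simp

text \<open>
The iterated commutation relation applied to the point mass at the empty partition. That functional
is killed by \<open>raise j\<close> for \<open>j > 0\<close>, so only the terms survive in which the
chain takes up the whole strip.
\<close>

lemma pieri: "conv (complete a) (kostka mu) ka = (\<Sum>rh\<in>up mu a. kostka rh ka)"
proof -
  have "(\<Sum>rh\<in>up mu a. kostka rh ka) = raise a (fold lower ka (delta empty_partition)) mu"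
    by (simp add: raise_def kostka_def)
  also have "\<dots> = conv (complete a) (kostka mu) ka"
    unfolding raise_fold_lower conv_def
    by (intro sum.cong) (auto simp: raise_delta_empty complete_def kostka_def fold_lower_zero)
  finally show ?thesis by simp
qed

lemma kostka_empty: "kostka empty_partition = complete 0"
  by (auto simp: kostka_def fold_lower_empty complete_def delta_def fun_eq_iff)

lemma fold_lower_support:
  assumes "\<And>la. g la \<noteq> 0 \<Longrightarrow> psize la = d" and "fold lower ka g la \<noteq> 0"
  shows "psize la = d + sum_list ka"
  using assms
proof (induction ka arbitrary: g d)
  case (Cons a ka)
  have "psize la = d + a" if "lower a g la \<noteq> 0" for la
  proof -
    from that obtain ta where "ta \<in> down la a" "g ta \<noteq> 0"
      unfolding lower_def by (meson sum.not_neutral_contains_not_neutral)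
    with Cons.prems(1) show ?thesis by (auto simp: down_def)
  qed
  from Cons.IH[of "lower a g" "d + a", OF this] Cons.prems(2) show ?case by simp
qed auto

lemma lower_support:
  assumes "\<And>la. g la \<noteq> 0 \<Longrightarrow> psize la = d" and "lower a g la \<noteq> 0"
  shows "psize la = d + a"
  using fold_lower_support[of g d "[a]" la] assms by simp

lemma kostka_support: "kostka la ka \<noteq> 0 \<Longrightarrow> psize la = sum_list ka"
  using fold_lower_support[of "delta empty_partition" 0 ka la]
  by (auto simp: kostka_def delta_def split: if_splits)

section \<open>Linear independence of the Schur functions\<close>

text \<open>
If \<open>ta\<close> is \<open>la\<close> without its last row and \<open>a\<close> is the length of
that row, then every other member of \<open>up ta a\<close> has fewer rows than \<open>la\<close> or
a shorter last one. In terms of Schur functions, Pieri's formula writes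
\<open>S\<^bsub>\<lambda>\<^esub>\<close> as \<open>h\<^sub>a S\<^bsub>\<tau>\<^esub>\<close> minus
Schur functions of partitions that are earlier in this sense. This replaces the triangularity of the
Kostka matrix.
\<close>

lemma partition_induct:
  assumes empty: "P empty_partition"
    and step: "\<And>ta la a. la \<in> up ta a \<Longrightarrow> P ta \<Longrightarrow> (\<And>rh. rh \<in> up ta a \<Longrightarrow> rh \<noteq> la \<Longrightarrow> P rh) \<Longrightarrow> P la"
  shows "P la"
proof -
  have "row la k = 0 \<Longrightarrow> P la" for k la
  proof (induction k arbitrary: la)
    case 0
    have "row la i = 0" for i using row_zero_mono[OF 0, of i] by simp
    then have "la = empty_partition" by (intro partition_eqI) simp
    with empty show ?case by simp
  next
    case (Suc k)
    from Suc.prems show ?case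
    proof (induction "row la k" arbitrary: la rule: less_induct)
      case less
      define ta where "ta = of_rows (\<lambda>i. if i < k then row la i else 0)"
      have row_ta: "row ta i = (if i < k then row la i else 0)" for i
        unfolding ta_def by (subst row_of_rows[where n = k]) (auto simp: row_antimono)
      have above: "row la i = 0" if "k < i" for i
        using row_zero_mono[OF less.prems] that by simp
      have strip: "hstrip ta la"
        unfolding hstrip_def using row_ta above by (auto simp: row_antimono)
      have psize_ta: "psize ta = (\<Sum>i<k. row la i)"
        by (subst psize_eq_sum_row[of _ k]) (auto simp: row_ta)
      have up: "la \<in> up ta (row la k)"
        using strip psize_eq_sum_row[OF less.prems] by (auto simp: up_def psize_ta)
      moreover have "P ta" by (rule Suc.IH) (simp add: row_ta)
      moreover have "P rh" if rh: "rh \<in> up ta (row la k)" "rh \<noteq> la" for rh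
      proof (rule less.hyps)
        have h: "row ta i \<le> row rh i" "row rh (Suc i) \<le> row ta i" for i
          using rh by (auto simp: up_def hstrip_def)
        show z: "row rh (Suc k) = 0" using h(2)[of k] by (simp add: row_ta)
        have eq: "(\<Sum>i<k. row rh i) + row rh k = (\<Sum>i<k. row la i) + row la k"
          using rh psize_eq_sum_row[OF z] by (simp add: up_def psize_ta)
        have ge: "row la i \<le> row rh i" if "i < k" for i
          using h(1)[of i] that by (simp add: row_ta)
        show "row rh k < row la k"
        proof (rule ccontr)
          assume not: "\<not> row rh k < row la k"
          have le: "(\<Sum>i<k. row la i) \<le> (\<Sum>i<k. row rh i)" by (intro sum_mono) (simp add: ge)
          with not eq have eqs: "(\<Sum>i<k. row la i) = (\<Sum>i<k. row rh i)" "row rh k = row la k" by linarith+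
          have "row rh i = row la i" if "i < k" for i
          proof (rule ccontr)
            assume "row rh i \<noteq> row la i"
            with ge[OF that] have "row la i < row rh i" by simp
            then have "(\<Sum>i<k. row la i) < (\<Sum>i<k. row rh i)"
              using that by (intro sum_strict_mono_ex1) (auto simp: ge)
            with eqs show False by simp
          qed
          moreover have "row rh i = row la i" if "k < i" for i
            using row_zero_mono[OF z, of i] above[OF that] that by simp
          ultimately have "row rh i = row la i" for i
            using eqs by (cases i k rule: linorder_cases) auto
          then have "rh = la" by (rule partition_eqI)
          with rh show False by simp
        qed
      qed
      ultimately show ?case by (rule step)
    qed
  qed
  then show ?thesis using ex_row_zero by blast
qed

text \<open>
It suffices that every point mass is an integer combination of functionals of the form \<open>fold
lower ka (delta empty_partition)\<close>, since the hypothesis says that all of these vanish on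
\<open>c\<close>. The span of these functionals is closed under \<open>lower a\<close>, and
\<open>lower a (delta ta)\<close> is the sum of the point masses on \<open>up ta a\<close>, so the
induction over partitions applies.
\<close>

lemma kostka_independent:
  assumes fin: "finite A" and zero: "\<And>ka. (\<Sum>rh\<in>A. c rh * kostka rh ka) = 0" and "la \<in> A"
  shows "c la = 0"
proof -
  have "\<forall>ka. (\<Sum>rh\<in>A. c rh * fold lower ka (delta la) rh) = 0" for la
  proof (induction la rule: partition_induct)
    case 1
    show ?case using zero by (simp add: kostka_def)
  next
    case (2 ta la a)
    have "delta la = (\<lambda>mu. lower a (delta ta) mu - (\<Sum>rh\<in>up ta a - {la}. delta rh mu))"
    proof
      fix mu
      have "lower a (delta ta) mu = (if mu \<in> up ta a then 1 else 0)"
        by (simp add: lower_def delta_def sum.delta' in_up_iff_in_down)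
      also have "\<dots> = (\<Sum>rh\<in>up ta a. delta rh mu)"
        by (simp add: delta_def)
      also have "\<dots> = delta la mu + (\<Sum>rh\<in>up ta a - {la}. delta rh mu)"
        using 2(1) by (intro sum.remove) auto
      finally show "delta la mu = lower a (delta ta) mu - (\<Sum>rh\<in>up ta a - {la}. delta rh mu)" by simp
    qed
    then have eq: "fold lower ka (delta la) mu =
       fold lower (a # ka) (delta ta) mu - (\<Sum>rh\<in>up ta a - {la}. fold lower ka (delta rh) mu)" for ka mu
      by (simp add: fold_lower_diff fold_lower_sum_1)
    show ?case
    proof
      fix ka
      have "(\<Sum>nu\<in>A. c nu * fold lower ka (delta la) nu) =
        (\<Sum>nu\<in>A. c nu * fold lower (a # ka) (delta ta) nu) -
        (\<Sum>rh\<in>up ta a - {la}. \<Sum>nu\<in>A. c nu * fold lower ka (delta rh) nu)"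
        unfolding eq right_diff_distrib sum_subtractf sum_distrib_left
        by (subst (2) sum.swap) simp
      also have "\<dots> = 0" using 2(2,3) by (simp del: fold_Cons)
      finally show "(\<Sum>nu\<in>A. c nu * fold lower ka (delta la) nu) = 0" .
    qed
  qed
  from this[of la] have "(\<Sum>rh\<in>A. c rh * delta la rh) = 0" by (metis fold_simps(1))
  with fin \<open>la \<in> A\<close> show ?thesis by (simp add: delta_def sum.delta if_distrib cong: if_cong)
qed

section \<open>Structure coefficients\<close>

lemma expansion_unique:
  assumes "\<And>ka. (\<Sum>nu | psize nu = d. c nu * kostka nu ka) = (\<Sum>nu | psize nu = d. c' nu * kostka nu ka)"
    and "psize nu = d"
  shows "c nu = c' nu"
proof -
  have "(\<Sum>nu | psize nu = d. (c nu - c' nu) * kostka nu ka) = 0" for ka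
    using assms(1)[of ka] by (simp add: left_diff_distrib sum_subtractf)
  then have "c nu - c' nu = 0"
    using assms(2) by (intro kostka_independent[where c = "\<lambda>nu. c nu - c' nu", OF finite_psize_eq]) auto
  then show ?thesis by simp
qed

lemma conv_complete_expansion:
  "conv (complete a) (\<lambda>x. \<Sum>nu | psize nu = d. c nu * kostka nu x) ka =
    (\<Sum>nu | psize nu = d + a. lower a c nu * kostka nu ka)"
proof -
  have "conv (complete a) (\<lambda>x. \<Sum>nu | psize nu = d. c nu * kostka nu x) ka =
     (\<Sum>nu | psize nu = d. c nu * raise a (\<lambda>rh. kostka rh ka) nu)"
    by (simp add: conv_sum_right pieri raise_def)
  then show ?thesis by (simp add: raise_adjoint)
qed

definition is_expansion :: "partition \<Rightarrow> partition \<Rightarrow> (partition \<Rightarrow> int) \<Rightarrow> bool" where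
  "is_expansion la mu c \<longleftrightarrow> (\<forall>nu. c nu \<noteq> 0 \<longrightarrow> psize nu = psize la + psize mu) \<and>
    (\<forall>ka. conv (kostka la) (kostka mu) ka = (\<Sum>nu | psize nu = psize la + psize mu. c nu * kostka nu ka))"

lemma conv_complete_kostka:
  assumes la: "la \<in> up ta a"
  shows "conv (conv (complete a) (kostka ta)) g ka = conv (kostka la) g ka + (\<Sum>rh\<in>up ta a - {la}. conv (kostka rh) g ka)"
proof -
  have "conv (complete a) (kostka ta) = (\<lambda>x. \<Sum>rh\<in>up ta a. 1 * kostka rh x)"
    by (simp add: pieri fun_eq_iff)
  then have "conv (conv (complete a) (kostka ta)) g ka = (\<Sum>rh\<in>up ta a. 1 * conv (kostka rh) g ka)"
    by (simp only: conv_sum_left)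
  then show ?thesis by (simp add: sum.remove[OF finite_up la])
qed

text \<open>
Existence of the Schur expansion of a product, by induction on the first factor: multiplying by
\<open>h\<^sub>a\<close> preserves expansions by Pieri's formula, and
\<open>S\<^bsub>\<lambda>\<^esub>\<close> is \<open>h\<^sub>a S\<^bsub>\<tau>\<^esub>\<close> minus
Schur functions for which the claim is known, where \<open>\<tau>\<close> is
\<open>\<lambda>\<close> without its last row, of length \<open>a\<close>.
\<close>

lemma expansion_exists: "\<exists>c. is_expansion la mu c"
proof (induction la rule: partition_induct)
  case 1
  have eq: "kostka mu = (\<lambda>x. \<Sum>nu | psize nu = psize mu. delta mu nu * kostka nu x)"
    by (simp add: fun_eq_iff sum_delta)
  have "conv (kostka empty_partition) (kostka mu) ka =
      (\<Sum>nu | psize nu = psize mu + 0. lower 0 (delta mu) nu * kostka nu ka)" for ka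
  proof -
    have "conv (kostka empty_partition) (kostka mu) ka =
        conv (complete 0) (\<lambda>x. \<Sum>nu | psize nu = psize mu. delta mu nu * kostka nu x) ka"
      unfolding kostka_empty by (rule arg_cong[where f = "\<lambda>f. conv (complete 0) f ka", OF eq])
    then show ?thesis unfolding conv_complete_expansion .
  qed
  moreover have "psize nu = psize mu + 0" if "lower 0 (delta mu) nu \<noteq> 0" for nu
    using that by (rule lower_support[rotated]) (auto simp: delta_def split: if_splits)
  ultimately show ?case unfolding is_expansion_def by auto
next
  case (2 ta la a)
  from 2(2) obtain c where c: "is_expansion ta mu c" by blast
  from 2(3) have "\<forall>rh\<in>up ta a - {la}. \<exists>c. is_expansion rh mu c" by auto
  then obtain cr where cr: "\<And>rh. rh \<in> up ta a - {la} \<Longrightarrow> is_expansion rh mu (cr rh)" by metis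
  have size_up: "psize rh = psize ta + a" if "rh \<in> up ta a" for rh
    using that by (simp add: up_def)
  let ?c = "\<lambda>nu. lower a c nu - (\<Sum>rh\<in>up ta a - {la}. cr rh nu)"
  have "psize nu = psize la + psize mu" if "?c nu \<noteq> 0" for nu
  proof (rule ccontr)
    assume ne: "psize nu \<noteq> psize la + psize mu"
    have "lower a c nu = 0"
      using lower_support[of c "psize ta + psize mu" a nu] c ne size_up[OF 2(1)]
      by (auto simp: is_expansion_def)
    moreover have "(\<Sum>rh\<in>up ta a - {la}. cr rh nu) = 0"
      using cr ne size_up 2(1) by (intro sum.neutral) (auto simp: is_expansion_def)
    ultimately show False using that by simp
  qed
  moreover have "conv (kostka la) (kostka mu) ka = (\<Sum>nu | psize nu = psize la + psize mu. ?c nu * kostka nu ka)" for ka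
  proof -
    let ?P = "{nu. psize nu = psize la + psize mu}"
    have "conv (kostka ta) (kostka mu) = (\<lambda>x. \<Sum>nu | psize nu = psize ta + psize mu. c nu * kostka nu x)"
      using c by (auto simp: is_expansion_def)
    then have "conv (conv (complete a) (kostka ta)) (kostka mu) ka = (\<Sum>nu\<in>?P. lower a c nu * kostka nu ka)"
      unfolding conv_assoc[symmetric]
      by (simp add: conv_complete_expansion size_up[OF 2(1)] ac_simps)
    moreover have "conv (kostka rh) (kostka mu) ka = (\<Sum>nu\<in>?P. cr rh nu * kostka nu ka)"
      if "rh \<in> up ta a - {la}" for rh
      using cr[OF that] that size_up 2(1) by (auto simp: is_expansion_def)
    ultimately have "conv (kostka la) (kostka mu) ka = (\<Sum>nu\<in>?P. lower a c nu * kostka nu ka)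
       - (\<Sum>rh\<in>up ta a - {la}. \<Sum>nu\<in>?P. cr rh nu * kostka nu ka)"
      using conv_complete_kostka[OF 2(1), of "kostka mu" ka] by simp
    also have "\<dots> = (\<Sum>nu\<in>?P. ?c nu * kostka nu ka)"
      unfolding left_diff_distrib sum_subtractf sum_distrib_right
      by (subst (2) sum.swap) simp
    finally show ?thesis .
  qed
  ultimately have "is_expansion la mu ?c" by (auto simp: is_expansion_def)
  then show ?case by blast
qed

definition lr :: "partition \<Rightarrow> partition \<Rightarrow> partition \<Rightarrow> int" where
  "lr la mu = (SOME c. is_expansion la mu c)"

lemma is_expansion_lr: "is_expansion la mu (lr la mu)"
  unfolding lr_def by (rule someI_ex[OF expansion_exists])

lemma lr_support: "lr la mu nu \<noteq> 0 \<Longrightarrow> psize nu = psize la + psize mu"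
  using is_expansion_lr by (simp add: is_expansion_def)

text \<open>
Only partitions of size \<open>sum_list ka\<close> contribute on the right, and only those of size
\<open>psize la + psize mu\<close> have a nonzero coefficient. The sum may run over either set.
\<close>

lemma conv_kostka:
  "conv (kostka la) (kostka mu) ka = (\<Sum>nu | psize nu = d. lr la mu nu * kostka nu ka)"
  if "d = psize la + psize mu \<or> d = sum_list ka"
proof -
  have *: "conv (kostka la) (kostka mu) ka = (\<Sum>nu | psize nu = psize la + psize mu. lr la mu nu * kostka nu ka)"
    using is_expansion_lr by (simp add: is_expansion_def)
  show ?thesis
  proof (cases "d = psize la + psize mu")
    case False
    then have "kostka nu ka = 0" if "psize nu = psize la + psize mu" for nu
      using kostka_support[of nu ka] that \<open>_ \<or> _\<close> by auto
    moreover have "lr la mu nu = 0" if "psize nu = d" for nu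
      using lr_support[of la mu nu] that False by auto
    ultimately show ?thesis using * by simp
  qed (use * in simp)
qed

lemma lr_commute: "lr la mu = lr mu la"
proof
  fix nu
  show "lr la mu nu = lr mu la nu"
  proof (cases "psize nu = psize la + psize mu")
    case True
    show ?thesis
    proof (rule expansion_unique[OF _ True])
      fix ka
      have "(\<Sum>nu | psize nu = psize la + psize mu. lr la mu nu * kostka nu ka) = conv (kostka la) (kostka mu) ka"
        by (rule conv_kostka[symmetric]) simp
      also have "\<dots> = conv (kostka mu) (kostka la) ka" by (simp only: conv_commute)
      also have "\<dots> = (\<Sum>nu | psize nu = psize la + psize mu. lr mu la nu * kostka nu ka)"
        by (rule conv_kostka) simp
      finally show "(\<Sum>nu | psize nu = psize la + psize mu. lr la mu nu * kostka nu ka) =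
        (\<Sum>nu | psize nu = psize la + psize mu. lr mu la nu * kostka nu ka)" .
    qed
  next
    case False
    then have "lr la mu nu = 0" "lr mu la nu = 0"
      using lr_support[of la mu nu] lr_support[of mu la nu] by linarith+
    then show ?thesis by simp
  qed
qed

section \<open>Skew Schur functions\<close>

text \<open>
Both sides are the coefficient of \<open>S\<^bsub>\<nu>\<^esub>\<close> in \<open>h\<^sub>a
S\<^bsub>\<tau>\<^esub> S\<^bsub>\<mu>\<^esub>\<close>. On the left \<open>h\<^sub>a\<close> is
first multiplied with \<open>S\<^bsub>\<tau>\<^esub>\<close>, on the right with
\<open>S\<^bsub>\<tau>\<^esub> S\<^bsub>\<mu>\<^esub>\<close>.
\<close>

lemma raise_lr: "raise a (\<lambda>la. lr la mu nu) ta = lower a (lr ta mu) nu"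
proof (cases "psize nu = psize ta + psize mu + a")
  case True
  then show ?thesis
  proof (rule expansion_unique[rotated])
    fix ka
    have "(\<Sum>nu | psize nu = psize ta + psize mu + a. lower a (lr ta mu) nu * kostka nu ka) =
      conv (complete a) (conv (kostka ta) (kostka mu)) ka"
    proof -
      have "conv (kostka ta) (kostka mu) = (\<lambda>x. \<Sum>nu | psize nu = psize ta + psize mu. lr ta mu nu * kostka nu x)"
        by (rule ext, rule conv_kostka) simp
      then show ?thesis by (simp only: conv_complete_expansion)
    qed
    also have "\<dots> = conv (\<lambda>x. \<Sum>la\<in>up ta a. 1 * kostka la x) (kostka mu) ka"
      unfolding conv_assoc by (simp add: pieri[abs_def])
    also have "\<dots> = (\<Sum>la\<in>up ta a. conv (kostka la) (kostka mu) ka)"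
      unfolding conv_sum_left by simp
    also have "\<dots> = (\<Sum>la\<in>up ta a. \<Sum>nu | psize nu = psize ta + psize mu + a. lr la mu nu * kostka nu ka)"
      by (intro sum.cong conv_kostka) (auto simp: up_def)
    also have "\<dots> = (\<Sum>nu | psize nu = psize ta + psize mu + a. raise a (\<lambda>la. lr la mu nu) ta * kostka nu ka)"
      by (subst sum.swap) (simp add: raise_def sum_distrib_right)
    finally show "(\<Sum>nu | psize nu = psize ta + psize mu + a. raise a (\<lambda>la. lr la mu nu) ta * kostka nu ka) =
      (\<Sum>nu | psize nu = psize ta + psize mu + a. lower a (lr ta mu) nu * kostka nu ka)" by simp
  qed
next
  case False
  then have "lower a (lr ta mu) nu = 0"
    using lower_support[of "lr ta mu" "psize ta + psize mu" a nu] lr_support by auto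
  moreover have "lr la mu nu = 0" if "la \<in> up ta a" for la
    using lr_support[of la mu nu] False that by (auto simp: up_def)
  ultimately show ?thesis by (simp add: raise_def)
qed

text \<open>
As a functional, \<open>g\<close> composed with the adjoint of the multiplication by
\<open>S\<^bsub>\<mu>\<^esub>\<close>. It takes the point mass at the empty partition to the point
mass at \<open>mu\<close>.
\<close>

definition skew :: "partition \<Rightarrow> (partition \<Rightarrow> int) \<Rightarrow> partition \<Rightarrow> int" where
  "skew mu g nu = (\<Sum>la | psize la + psize mu = psize nu. lr la mu nu * g la)"

lemma lower_skew: "lower a (skew mu g) = skew mu (lower a g)"
proof
  fix nu
  show "lower a (skew mu g) nu = skew mu (lower a g) nu"
  proof (cases "a + psize mu \<le> psize nu")
    case True
    then obtain d where d: "psize nu = d + a + psize mu" by (metis add.commute add.left_commute le_Suc_ex)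
    have "skew mu (lower a g) nu = (\<Sum>la | psize la = d + a. lower a g la * lr la mu nu)"
      by (simp add: skew_def d mult.commute)
    also have "\<dots> = (\<Sum>ta | psize ta = d. g ta * lower a (lr ta mu) nu)"
      by (simp add: raise_adjoint[symmetric] raise_lr)
    also have "\<dots> = (\<Sum>ta | psize ta = d. \<Sum>rh\<in>down nu a. lr ta mu rh * g ta)"
      by (simp add: lower_def sum_distrib_left mult.commute)
    also have "\<dots> = (\<Sum>rh\<in>down nu a. \<Sum>ta | psize ta = d. lr ta mu rh * g ta)"
      by (rule sum.swap)
    also have "\<dots> = lower a (skew mu g) nu"
      unfolding lower_def skew_def by (intro sum.cong) (auto simp: down_def d)
    finally show ?thesis by simp
  next
    case False
    then have "{ta. psize ta + psize mu = psize rh} = {}" if "rh \<in> down nu a" for rh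
      using that by (auto simp: down_def)
    then have "lower a (skew mu g) nu = 0" by (simp add: lower_def skew_def)
    moreover have "lower a g la = 0" if "psize la + psize mu = psize nu" for la
    proof -
      have "down la a = {}" using that False by (auto simp: down_def)
      then show ?thesis by (simp add: lower_def)
    qed
    ultimately show ?thesis by (simp add: skew_def)
  qed
qed

lemma fold_lower_skew: "fold lower ka (skew mu g) = skew mu (fold lower ka g)"
  by (induction ka arbitrary: g) (simp_all add: lower_skew)

lemma lr_empty: "lr empty_partition mu = delta mu"
proof
  fix nu
  show "lr empty_partition mu nu = delta mu nu"
  proof (cases "psize nu = psize mu")
    case True
    show ?thesis
    proof (rule expansion_unique[OF _ True])
      fix ka
      have "(\<Sum>nu | psize nu = psize mu. lr empty_partition mu nu * kostka nu ka) =
         conv (kostka empty_partition) (kostka mu) ka"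
        by (rule conv_kostka[symmetric]) simp
      also have "\<dots> = kostka mu ka" by (simp add: kostka_empty pieri up_0)
      also have "\<dots> = (\<Sum>nu | psize nu = psize mu. delta mu nu * kostka nu ka)"
        by (simp add: sum_delta)
      finally show "(\<Sum>nu | psize nu = psize mu. lr empty_partition mu nu * kostka nu ka) =
        (\<Sum>nu | psize nu = psize mu. delta mu nu * kostka nu ka)" .
    qed
  next
    case False
    then show ?thesis using lr_support[of empty_partition mu nu] by (auto simp: delta_def)
  qed
qed

text \<open>
The skew Schur function of shape \<open>nu / mu\<close> is \<open>\<Sum>\<^sub>\<lambda> c(\<nu>;
\<lambda>, \<mu>) S\<^bsub>\<lambda>\<^esub>\<close>. Both sides agree on the empty chain and, since
\<open>skew mu\<close> commutes with removing strips, they stay equal along every chain.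
\<close>

lemma skew_kostka:
  "fold lower ka (delta mu) nu = (\<Sum>la | psize la + psize mu = psize nu. lr la mu nu * kostka la ka)"
proof -
  have "skew mu (delta empty_partition) = delta mu"
  proof
    fix nu
    have "skew mu (delta empty_partition) nu = (\<Sum>la | psize la + psize mu = psize nu.
        if la = empty_partition then lr empty_partition mu nu else 0)"
      unfolding skew_def by (intro sum.cong) (auto simp: delta_def)
    also have "\<dots> = delta mu nu"
    proof -
      have "finite {la. psize la + psize mu = psize nu}"
        by (rule finite_subset[OF _ finite_psize_le[of "psize nu"]]) auto
      then show ?thesis by (auto simp: sum.delta lr_empty delta_def)
    qed
    finally show "skew mu (delta empty_partition) nu = delta mu nu" .
  qed
  then have "fold lower ka (delta mu) = skew mu (fold lower ka (delta empty_partition))"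
    by (metis fold_lower_skew)
  then show ?thesis by (simp add: skew_def kostka_def)
qed

section \<open>The sum of all Schur functions\<close>

abbreviation ones :: "partition \<Rightarrow> int" where "ones \<equiv> (\<lambda>_. 1)"

text \<open>
The coefficient form of \<open>\<Sum>\<^sub>\<nu> S\<^bsub>\<nu>/\<lambda>\<^esub> =
(\<Sum>\<^sub>\<beta> S\<^bsub>\<beta>\<^esub>) (\<Sum>\<^sub>\<nu>
S\<^bsub>\<lambda>/\<nu>\<^esub>)\<close>. By induction on the number of variables, the strips of
all later variables are already turned into removals. The strip of the first variable is moved past
them with \<open>raise_fold_lower\<close>, where it meets the constant functional and becomes a
removal by \<open>raise_one\<close>. All factors that arise are collected in a series
\<open>M\<close> that is the same for all \<open>la\<close>. On the empty partition nothing can be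
removed, so evaluation there identifies \<open>M\<close> as the sum of all Schur functions.
\<close>

lemma foldr_raise_ones:
  "foldr raise ka ones la =
    (\<Sum>(x, y) \<in> splits ka. foldr raise x ones empty_partition * fold lower y ones la)"
proof (induction "length ka" arbitrary: ka la)
  case 0
  then show ?case by simp
next
  case (Suc n)
  from Suc.hyps(2) obtain a ka' where ka: "ka = a # ka'" "length ka' = n" by (cases ka) auto
  let ?N = "\<lambda>x. foldr raise x ones empty_partition"
  \<comment> \<open>Of the first exponent, \<open>b\<close> is absorbed by the factor: \<open>sum_list y\<close> of it by the boxes shared with later
      strips, the rest by the excess of row 0. Hence the bound.\<close>
  define M where "M b v = (\<Sum>(x, y) \<in> splits v. if sum_list y \<le> b then ?N x else 0)" for b v
  have step: "foldr raise (a # v) ones la =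
      (\<Sum>(x, z) \<in> splits (a # v). M (hd x) (tl x) * fold lower z ones la)"
    if "length v = n" for a v la
  proof -
    let ?t = "\<lambda>x y z l. if l + sum_list y \<le> a then ?N x * fold lower (l # z) ones la else 0"
    have inner: "raise a (fold lower w ones) la =
        (\<Sum>(y, z) \<in> splits w. \<Sum>l\<le>a. if l + sum_list y \<le> a then fold lower (l # z) ones la else 0)" for w
    proof -
      have "(if sum_list y \<le> a then fold lower z (raise (a - sum_list y) ones) la else 0) =
        (\<Sum>l\<le>a. if l + sum_list y \<le> a then fold lower (l # z) ones la else 0)" for y z
      proof (cases "sum_list y \<le> a")
        case True
        have "raise (a - sum_list y) ones = (\<lambda>la. \<Sum>l\<le>a - sum_list y. lower l ones la)"
          by (rule ext) (rule raise_one)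
        then have "fold lower z (raise (a - sum_list y) ones) la = (\<Sum>l\<le>a - sum_list y. fold lower (l # z) ones la)"
          by (simp add: fold_lower_sum_1)
        also have "\<dots> = (\<Sum>l\<le>a. if l + sum_list y \<le> a then fold lower (l # z) ones la else 0)"
          using True by (intro sum.mono_neutral_cong_left) auto
        finally show ?thesis using True by simp
      qed simp
      then show ?thesis unfolding raise_fold_lower by simp
    qed
    have "foldr raise v ones = (\<lambda>la. \<Sum>p \<in> splits v. ?N (fst p) * fold lower (snd p) ones la)"
      using Suc.hyps(1)[of v] that by (simp add: fun_eq_iff case_prod_unfold)
    then have "foldr raise (a # v) ones la = (\<Sum>(x, w) \<in> splits v. ?N x * raise a (fold lower w ones) la)"
      by (simp add: raise_sum case_prod_unfold)
    also have "\<dots> = (\<Sum>(x, w) \<in> splits v. \<Sum>(y, z) \<in> splits w. \<Sum>l\<le>a. ?t x y z l)"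
      unfolding inner by (simp add: sum_distrib_left case_prod_unfold if_distrib cong: if_cong)
    also have "\<dots> = (\<Sum>(u, z) \<in> splits v. \<Sum>(x, y) \<in> splits u. \<Sum>l\<le>a. ?t x y z l)"
      by (rule sum_splits_assoc)
    also have "\<dots> = (\<Sum>(u, z) \<in> splits v. \<Sum>l\<le>a. M (a - l) u * fold lower (l # z) ones la)"
    proof (intro sum.cong refl, clarify)
      fix u z
      have "(\<Sum>(x, y) \<in> splits u. \<Sum>l\<le>a. ?t x y z l) = (\<Sum>l\<le>a. \<Sum>(x, y) \<in> splits u. ?t x y z l)"
        unfolding case_prod_unfold by (rule sum.swap)
      also have "\<dots> = (\<Sum>l\<le>a. M (a - l) u * fold lower (l # z) ones la)"
        unfolding M_def sum_distrib_right
        by (intro sum.cong refl) auto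
      finally show "(\<Sum>(x, y) \<in> splits u. \<Sum>l\<le>a. ?t x y z l) = (\<Sum>l\<le>a. M (a - l) u * fold lower (l # z) ones la)" .
    qed
    also have "\<dots> = (\<Sum>l\<le>a. \<Sum>(u, z) \<in> splits v. M (a - l) u * fold lower (l # z) ones la)"
      unfolding case_prod_unfold by (rule sum.swap)
    also have "\<dots> = (\<Sum>k\<le>a. \<Sum>(u, z) \<in> splits v. M k u * fold lower ((a - k) # z) ones la)"
      by (rule sum.reindex_bij_witness[where i = "\<lambda>l. a - l" and j = "\<lambda>l. a - l"]) auto
    also have "\<dots> = (\<Sum>(x, z) \<in> splits (a # v). M (hd x) (tl x) * fold lower z ones la)"
      unfolding sum_splits_Cons by simp
    finally show ?thesis .
  qed
  have top: "?N (b # v) = M b v" if "length v = n" for b v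
  proof -
    have "?N (b # v) = (\<Sum>(x, z) \<in> splits (b # v). M (hd x) (tl x) * fold lower z ones empty_partition)"
      by (rule step[OF that])
    also have "\<dots> = (\<Sum>(x, z) \<in> splits (b # v). if sum_list z = 0 then M (hd x) (tl x) else 0)"
      by (intro sum.cong refl) (auto simp: fold_lower_empty)
    also have "\<dots> = M b v" by (simp only: sum_splits_zero list.sel)
    finally show ?thesis .
  qed
  show ?case
    unfolding ka step[OF ka(2)]
  proof (intro sum.cong refl, clarify)
    fix x z assume "(x, z) \<in> splits (a # ka')"
    then have "length x = length (a # ka')"
      unfolding splits_iff by (metis length_map length_zip min.idem)
    then obtain b v where "x = b # v" "length v = n" using ka(2) by (cases x) auto
    then show "M (hd x) (tl x) * fold lower z ones la = ?N x * fold lower z ones la"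
      using top by simp
  qed
qed

section \<open>The identity for structure coefficients\<close>

lemma fold_lower_cong:
  assumes "\<And>nu. psize nu \<le> psize la \<Longrightarrow> g nu = h nu"
  shows "fold lower ka g la = fold lower ka h la"
  using assms
proof (induction ka arbitrary: g h)
  case (Cons a ka)
  have "lower a g nu = lower a h nu" if "psize nu \<le> psize la" for nu
    unfolding lower_def using that by (intro sum.cong Cons.prems) (auto simp: down_def)
  then have "fold lower ka (lower a g) la = fold lower ka (lower a h) la" by (rule Cons.IH)
  then show ?case by simp
qed simp

text \<open>
This is \<open>\<Sum>\<^sub>\<nu> S\<^bsub>\<lambda>/\<nu>\<^esub>\<close> in the Schur basis. The
bounds on the sizes only serve to make the sums finite.
\<close>

lemma fold_lower_ones:
  "fold lower ka ones la = (\<Sum>(nu, ta) \<in> {nu. psize nu \<le> psize la} \<times> {ta. psize ta \<le> psize la}.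
    lr ta nu la * kostka ta ka)"
proof -
  let ?Q = "{nu. psize nu \<le> psize la}"
  have "fold lower ka ones la = fold lower ka (\<lambda>x. \<Sum>nu\<in>?Q. delta nu x) la"
    by (rule fold_lower_cong) (simp add: delta_def)
  also have "\<dots> = (\<Sum>nu\<in>?Q. fold lower ka (delta nu) la)"
    by (simp add: fold_lower_sum_1)
  also have "\<dots> = (\<Sum>nu\<in>?Q. \<Sum>ta\<in>?Q. lr ta nu la * kostka ta ka)"
    unfolding skew_kostka
  proof (rule sum.cong[OF refl], rule sum.mono_neutral_left)
    fix nu
    have "lr ta nu la = 0" if "psize ta + psize nu \<noteq> psize la" for ta
      using lr_support[of ta nu la] that by auto
    then show "\<forall>ta \<in> ?Q - {ta. psize ta + psize nu = psize la}. lr ta nu la * kostka ta ka = 0"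
      by simp
  qed auto
  finally show ?thesis by (simp add: sum.cartesian_product)
qed

lemma foldr_raise_ones_kostka:
  "foldr raise ka ones la = (\<Sum>nu | psize nu = psize la + sum_list ka. fold lower ka (delta la) nu)"
  using foldr_raise_adjoint[where d = "psize la" and c = "delta la" and ka = ka and g = ones] by (simp add: sum_delta)

text \<open>
Both sides, multiplied by \<open>S\<^bsub>\<mu>\<^esub>\<close> and summed over all
\<open>mu\<close> of a given size, are Schur expansions of the homogeneous part of the same series
\<open>\<Sum>\<^sub>\<nu> S\<^bsub>\<nu>/\<lambda>\<^esub>\<close>: one by expanding each skew Schur
function, the other by expanding the factorisation \<open>foldr_raise_ones\<close>.
\<close>

lemma lr_sum:
  "(\<Sum>nu | psize nu = psize la + psize mu. lr mu la nu) =
    (\<Sum>be | psize be \<le> psize mu. \<Sum>(nu, ta) \<in> {nu. psize nu \<le> psize la} \<times> {ta. psize ta \<le> psize la}.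
       lr ta nu la * lr be ta mu)"
proof -
  let ?Q = "{nu. psize nu \<le> psize la} \<times> {ta. psize ta \<le> psize la}"
  let ?Q' = "{be. psize be \<le> psize mu}"
  define L where "L m = (\<Sum>nu | psize nu = psize la + psize mu. lr m la nu)" for m
  define R where "R m = (\<Sum>be\<in>?Q'. \<Sum>(nu, ta)\<in>?Q. lr ta nu la * lr be ta m)" for m
  have "L mu = R mu"
  proof (rule expansion_unique)
    fix ka
    show "(\<Sum>m | psize m = psize mu. L m * kostka m ka) = (\<Sum>m | psize m = psize mu. R m * kostka m ka)"
    proof (cases "sum_list ka = psize mu")
      case False
      then have "kostka m ka = 0" if "psize m = psize mu" for m
        using kostka_support[of m ka] that by auto
      then show ?thesis by simp
    next
      case True
      have "foldr raise ka ones la = (\<Sum>nu | psize nu = psize la + psize mu.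
          \<Sum>m | psize m = psize mu. lr m la nu * kostka m ka)"
        unfolding foldr_raise_ones_kostka skew_kostka True by (intro sum.cong) auto
      also have "\<dots> = (\<Sum>m | psize m = psize mu. L m * kostka m ka)"
        unfolding L_def sum_distrib_right by (rule sum.swap)
      finally have l: "foldr raise ka ones la = (\<Sum>m | psize m = psize mu. L m * kostka m ka)" .
      have N: "foldr raise x ones empty_partition = (\<Sum>be\<in>?Q'. 1 * kostka be x)"
        if "(x, y) \<in> splits ka" for x y
      proof -
        have "sum_list x \<le> psize mu" using sum_list_splits[OF that] True by simp
        moreover have "kostka be x = 0" if "psize be \<noteq> sum_list x" for be
          using kostka_support[of be x] that by auto
        ultimately have "(\<Sum>be | psize be = sum_list x. kostka be x) = (\<Sum>be\<in>?Q'. kostka be x)"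
          by (intro sum.mono_neutral_left) auto
        then show ?thesis by (simp add: foldr_raise_ones_kostka kostka_def)
      qed
      have "foldr raise ka ones la =
        conv (\<lambda>x. \<Sum>be\<in>?Q'. 1 * kostka be x) (\<lambda>y. \<Sum>p\<in>?Q. lr (snd p) (fst p) la * kostka (snd p) y) ka"
        unfolding foldr_raise_ones[of ka la] conv_def fold_lower_ones
        by (intro sum.cong) (auto simp: N case_prod_unfold)
      also have "\<dots> = (\<Sum>be\<in>?Q'. 1 * (\<Sum>p\<in>?Q. lr (snd p) (fst p) la * conv (kostka be) (kostka (snd p)) ka))"
        unfolding conv_sum_left conv_sum_right ..
      also have "\<dots> = (\<Sum>be\<in>?Q'. \<Sum>p\<in>?Q. \<Sum>m | psize m = psize mu. lr (snd p) (fst p) la * lr be (snd p) m * kostka m ka)"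
        using True by (simp add: conv_kostka[of "psize mu"] sum_distrib_left mult.assoc)
      also have "\<dots> = (\<Sum>be\<in>?Q'. \<Sum>m | psize m = psize mu. \<Sum>p\<in>?Q. lr (snd p) (fst p) la * lr be (snd p) m * kostka m ka)"
        by (intro sum.cong refl) (rule sum.swap)
      also have "\<dots> = (\<Sum>m | psize m = psize mu. \<Sum>be\<in>?Q'. \<Sum>p\<in>?Q. lr (snd p) (fst p) la * lr be (snd p) m * kostka m ka)"
        by (rule sum.swap)
      also have "\<dots> = (\<Sum>m | psize m = psize mu. R m * kostka m ka)"
        by (simp add: R_def sum_distrib_right case_prod_unfold)
      finally show ?thesis using l by simp
    qed
  qed simp
  then show ?thesis by (simp add: L_def R_def)
qed

section \<open>Semistandard tableaux as chains of horizontal strips\<close>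

lemma in_diagram_iff: "(i, j) \<in> diagram la \<longleftrightarrow> j < row la i"
  by (auto simp: diagram_def row_def nth_default_def)

lemma finite_diagram [simp]: "finite (diagram la)"
  and card_diagram: "card (diagram la) = psize la"
proof -
  obtain n where n: "row la n = 0" using ex_row_zero by blast
  have "i < n" if "j < row la i" for i j
    using row_zero_mono[OF n, of i] that by (cases "i < n") auto
  then have "diagram la = Sigma {..<n} (\<lambda>i. {..<row la i})"
    by (auto simp: in_diagram_iff)
  then show "finite (diagram la)" "card (diagram la) = psize la"
    by (simp_all add: psize_eq_sum_row[OF n])
qed

lemma lookup_tableau_weight:
  "poly_mapping.lookup (tableau_weight la T) v = card {c \<in> diagram la. T c = v}"
proof -
  have "poly_mapping.lookup (tableau_weight la T) v = (\<Sum>c\<in>diagram la. if T c = v then 1 else 0)"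
    unfolding tableau_weight_def lookup_sum by (simp add: lookup_single when_def cong: if_cong)
  also have "\<dots> = card {c \<in> diagram la. T c = v}"
    by (simp add: sum.If_cases Int_def)
  finally show ?thesis .
qed

lemma tableau_weight_eq_iff:
  "tableau_weight la T = Poly_Mapping.nth ka \<longleftrightarrow> (\<forall>v. card {c \<in> diagram la. T c = v} = nth_default 0 ka v)"
  by (simp add: poly_mapping_eq_iff fun_eq_iff lookup_tableau_weight)

definition tableaux :: "partition \<Rightarrow> nat list \<Rightarrow> (nat \<times> nat \<Rightarrow> nat) set" where
  "tableaux la ka = {T \<in> semistandard_tableaux la. tableau_weight la T = Poly_Mapping.nth ka}"

lemma tableaux_iff:
  "T \<in> tableaux la ka \<longleftrightarrow> T \<in> extensional (diagram la) \<and>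
    (\<forall>i j j'. j < j' \<longrightarrow> j' < row la i \<longrightarrow> T (i, j) \<le> T (i, j')) \<and>
    (\<forall>i i' j. i < i' \<longrightarrow> j < row la i' \<longrightarrow> T (i, j) < T (i', j)) \<and>
    (\<forall>v. card {c \<in> diagram la. T c = v} = nth_default 0 ka v)"
proof -
  have "j < row la i" if "i < i'" "j < row la i'" for i i' j
    using row_antimono[of i i' la] that by simp
  then show ?thesis
    unfolding tableaux_def semistandard_tableaux_def tableau_weight_eq_iff
    by (auto simp: in_diagram_iff PiE_def)
qed

lemma tableaux_entry_less:
  assumes "T \<in> tableaux la ka" "c \<in> diagram la"
  shows "T c < length ka"
proof (rule ccontr)
  assume "\<not> T c < length ka"
  then have "card {c' \<in> diagram la. T c' = T c} = 0"
    using assms(1) by (simp add: tableaux_iff nth_default_def)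
  with assms(2) show False by (cases c) auto
qed

lemma finite_tableaux [simp]: "finite (tableaux la ka)"
proof (rule finite_subset)
  show "tableaux la ka \<subseteq> diagram la \<rightarrow>\<^sub>E {..<length ka}"
    using tableaux_entry_less by (auto simp: PiE_def tableaux_iff)
qed (simp add: finite_PiE)

text \<open>
In a tableau of weight \<open>ka @ [a]\<close> the largest possible entry is \<open>n = length
ka\<close>. The boxes with smaller entries form the inner shape, and the boxes with entry
\<open>n\<close> a horizontal strip, because columns increase strictly.
\<close>

definition inner_shape :: "partition \<Rightarrow> nat \<Rightarrow> (nat \<times> nat \<Rightarrow> nat) \<Rightarrow> partition" where
  "inner_shape la n T = of_rows (\<lambda>i. card {j. j < row la i \<and> T (i, j) < n})"

lemma inner_shape_props:
  assumes T: "T \<in> tableaux la (ka @ [a])"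
  defines "ta \<equiv> inner_shape la (length ka) T"
  shows "diagram ta = {c \<in> diagram la. T c < length ka}" (is ?diag)
    and "ta \<in> down la a" (is ?down)
    and "restrict T (diagram ta) \<in> tableaux ta ka" (is ?tab)
proof -
  let ?n = "length ka"
  let ?S = "\<lambda>i. {j. j < row la i \<and> T (i, j) < ?n}"
  have rows: "T (i, j) \<le> T (i, j')" if "j \<le> j'" "j' < row la i" for i j j'
    using T that by (cases "j = j'") (auto simp: tableaux_iff)
  have cols: "T (i, j) < T (i', j)" if "i < i'" "j < row la i'" for i i' j
    using T that by (auto simp: tableaux_iff)
  have entry: "T (i, j) \<le> ?n" if "j < row la i" for i j
    using tableaux_entry_less[OF T, of "(i, j)"] that by (simp add: in_diagram_iff)
  have S: "?S i = {..<card (?S i)}" for i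
  proof -
    have dc: "j \<in> ?S i" if "j \<le> j'" "j' \<in> ?S i" for j j'
      using that rows[of j j' i] by auto
    have fin: "finite (?S i)" by simp
    show ?thesis
    proof (cases "?S i = {}")
      case False
      have "x \<in> ?S i \<longleftrightarrow> x \<le> Max (?S i)" for x
        using Max_ge[OF fin] dc[OF _ Max_in[OF fin False]] by blast
      then have "?S i = {..Max (?S i)}" by blast
      then show ?thesis by (metis card_atMost lessThan_Suc_atMost)
    next
      case True
      show ?thesis unfolding True by simp
    qed
  qed
  have row_ta: "row ta i = card (?S i)" for i
  proof -
    obtain n where n: "row la n = 0" using ex_row_zero by blast
    have "?S (Suc i) \<subseteq> ?S i" for i
      using cols[of i "Suc i"] row_antimono[of i "Suc i" la] by fastforce
    then have "card (?S (Suc i)) \<le> card (?S i)" for i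
      by (intro card_mono) auto
    then show ?thesis
      unfolding ta_def inner_shape_def by (subst row_of_rows[where n = n]) (auto simp: n)
  qed
  have mem: "j < row ta i \<longleftrightarrow> j < row la i \<and> T (i, j) < ?n" for i j
    using S[of i] unfolding row_ta by blast
  show diag: ?diag using mem by (auto simp: in_diagram_iff)
  have strip: "hstrip ta la"
    unfolding hstrip_def
  proof (intro allI conjI leI notI)
    fix i
    assume "row ta i < row la (Suc i)"
    then have "T (i, row ta i) < T (Suc i, row ta i)" "T (Suc i, row ta i) \<le> ?n" "row ta i < row la i"
      using cols entry row_antimono[of i "Suc i" la] by auto
    then show False using mem[of "row ta i" i] by simp
  next
    fix i
    assume "row la i < row ta i"
    then show False using mem[of "row la i" i] by simp
  qed
  have "diagram la = diagram ta \<union> {c \<in> diagram la. T c = ?n}"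
    using entry unfolding diag by (force simp: in_diagram_iff le_less)
  then have "card (diagram la) = card (diagram ta) + card {c \<in> diagram la. T c = ?n}"
    by (subst card_Un_disjoint[symmetric]) (auto simp: diag)
  moreover have "card {c \<in> diagram la. T c = ?n} = a"
    using T by (simp add: tableaux_iff nth_default_def nth_append)
  ultimately show ?down using strip by (simp add: down_def card_diagram)
  have "card {c \<in> diagram ta. restrict T (diagram ta) c = v} = nth_default 0 ka v" for v
  proof (cases "v < ?n")
    case True
    then have "{c \<in> diagram ta. restrict T (diagram ta) c = v} = {c \<in> diagram la. T c = v}"
      by (auto simp: diag)
    also have "card \<dots> = nth_default 0 (ka @ [a]) v" using T by (simp add: tableaux_iff)
    finally show ?thesis using True by (simp add: nth_default_def nth_append)
  next
    case False
    then have "{c \<in> diagram ta. restrict T (diagram ta) c = v} = {}" by (auto simp: diag)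
    then show ?thesis using False by (simp add: nth_default_def)
  qed
  moreover have R: "restrict T (diagram ta) (i, j) = T (i, j)" if "j < row ta i" for i j
    using that by (simp add: in_diagram_iff)
  moreover have "restrict T (diagram ta) (i, j) \<le> restrict T (diagram ta) (i, j')"
    if "j < j'" "j' < row ta i" for i j j'
  proof -
    have "j < row ta i" using that by simp
    then show ?thesis using that rows[of j j' i] mem[of j' i] by (simp add: R del: restrict_apply)
  qed
  moreover have "restrict T (diagram ta) (i, j) < restrict T (diagram ta) (i', j)"
    if "i < i'" "j < row ta i'" for i i' j
  proof -
    have "j < row ta i" using row_antimono[of i i' ta] that by simp
    then show ?thesis using that cols[of i i' j] mem[of j i'] by (simp add: R del: restrict_apply)
  qed
  ultimately show ?tab by (simp add: tableaux_iff)
qed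

definition extend_tableau :: "partition \<Rightarrow> nat \<Rightarrow> partition \<Rightarrow> (nat \<times> nat \<Rightarrow> nat) \<Rightarrow> nat \<times> nat \<Rightarrow> nat" where
  "extend_tableau la n ta T = restrict (\<lambda>c. if c \<in> diagram ta then T c else n) (diagram la)"

lemma extend_tableau_props:
  assumes ta: "ta \<in> down la a" and T: "T \<in> tableaux ta ka"
  defines "U \<equiv> extend_tableau la (length ka) ta T"
  shows "U \<in> tableaux la (ka @ [a])" (is ?tab)
    and "inner_shape la (length ka) U = ta" (is ?shape)
    and "restrict U (diagram ta) = T" (is ?restrict)
proof -
  let ?n = "length ka"
  have h: "row la (Suc i) \<le> row ta i" "row ta i \<le> row la i" for i
    using ta by (auto simp: down_def hstrip_def)
  have sub: "diagram ta \<subseteq> diagram la"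
    using h(2) by (force simp: in_diagram_iff intro: less_le_trans)
  have rows: "T (i, j) \<le> T (i, j')" if "j < j'" "j' < row ta i" for i j j'
    using T that by (auto simp: tableaux_iff)
  have cols: "T (i, j) < T (i', j)" if "i < i'" "j < row ta i'" for i i' j
    using T that by (auto simp: tableaux_iff)
  have entry: "T (i, j) < ?n" if "j < row ta i" for i j
    using tableaux_entry_less[OF T, of "(i, j)"] that by (simp add: in_diagram_iff)
  have U: "U (i, j) = (if j < row ta i then T (i, j) else ?n)" if "j < row la i" for i j
    using that by (simp add: U_def extend_tableau_def in_diagram_iff)
  have U_ext: "U \<in> extensional (diagram la)" by (simp add: U_def extend_tableau_def)
  have U_rows: "U (i, j) \<le> U (i, j')" if "j < j'" "j' < row la i" for i j j'
    using that U rows entry by (auto intro: less_imp_le)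
  have U_cols: "U (i, j) < U (i', j)" if "i < i'" "j < row la i'" for i i' j
  proof -
    have "row la i' \<le> row la (Suc i)" using that by (intro row_antimono) simp
    with that h(1)[of i] have "j < row ta i" by simp
    moreover from this have "j < row la i" using h(2)[of i] by simp
    ultimately show ?thesis using that U cols entry by auto
  qed
  have U_weight: "card {c \<in> diagram la. U c = v} = nth_default 0 (ka @ [a]) v" for v
  proof (cases v ?n rule: linorder_cases)
    case less
    then have "{c \<in> diagram la. U c = v} = {c \<in> diagram ta. T c = v}"
      using sub by (auto simp: U_def extend_tableau_def split: if_splits)
    also have "card \<dots> = nth_default 0 ka v" using T by (simp add: tableaux_iff)
    finally show ?thesis using less by (simp add: nth_default_def nth_append)
  next
    case equal
    have "T c \<noteq> ?n" if "c \<in> diagram ta" for c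
      using tableaux_entry_less[OF T that] by simp
    then have "{c \<in> diagram la. U c = v} = diagram la - diagram ta"
      by (auto simp: equal U_def extend_tableau_def split: if_splits)
    then have "card {c \<in> diagram la. U c = v} = a"
      using sub ta by (simp add: card_Diff_subset card_diagram down_def)
    then show ?thesis using equal by (simp add: nth_default_def nth_append)
  next
    case greater
    then have "{c \<in> diagram la. U c = v} = {}"
      using tableaux_entry_less[OF T] by (auto simp: U_def extend_tableau_def split: if_splits dest: order_less_trans)
    then show ?thesis using greater by (simp add: nth_default_def)
  qed
  show tab: ?tab using U_ext U_rows U_cols U_weight by (auto simp: tableaux_iff)
  have "diagram (inner_shape la ?n U) = diagram ta"
    unfolding inner_shape_props(1)[OF tab] using sub tableaux_entry_less[OF T]
    by (auto simp: U_def extend_tableau_def split: if_splits)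
  then have "j < row (inner_shape la ?n U) i \<longleftrightarrow> j < row ta i" for i j
    by (metis in_diagram_iff)
  then have "row (inner_shape la ?n U) i = row ta i" for i
    by (metis linorder_neqE_nat less_irrefl)
  then show ?shape by (rule partition_eqI)
  have "T \<in> extensional (diagram ta)" using T by (simp add: tableaux_iff)
  then show ?restrict
    using sub by (auto simp: U_def extend_tableau_def fun_eq_iff restrict_def extensional_def)
qed

lemma card_tableaux_snoc:
  "card (tableaux la (ka @ [a])) = (\<Sum>ta\<in>down la a. card (tableaux ta ka))"
proof -
  let ?n = "length ka"
  have "bij_betw (\<lambda>T. let ta = inner_shape la ?n T in (ta, restrict T (diagram ta)))
      (tableaux la (ka @ [a])) (Sigma (down la a) (\<lambda>ta. tableaux ta ka))"
  proof (rule bij_betw_byWitness[where f' = "\<lambda>(ta, T). extend_tableau la ?n ta T"])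
    show "\<forall>T\<in>tableaux la (ka @ [a]).
        (case (let ta = inner_shape la ?n T in (ta, restrict T (diagram ta))) of
          (ta, T) \<Rightarrow> extend_tableau la ?n ta T) = T"
    proof
      fix T assume T: "T \<in> tableaux la (ka @ [a])"
      note p = inner_shape_props[OF T]
      have "?n = T c" if "c \<in> diagram la" "\<not> T c < ?n" for c
        using tableaux_entry_less[OF T that(1)] that(2) by simp
      moreover have "T \<in> extensional (diagram la)" using T by (simp add: tableaux_iff)
      ultimately have "extend_tableau la ?n (inner_shape la ?n T) (restrict T (diagram (inner_shape la ?n T))) = T"
        unfolding extend_tableau_def p(1) by (auto simp: fun_eq_iff restrict_def extensional_def)
      then show "(case (let ta = inner_shape la ?n T in (ta, restrict T (diagram ta))) of
          (ta, T) \<Rightarrow> extend_tableau la ?n ta T) = T" by (simp add: Let_def)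
    qed
  qed (auto simp: Let_def inner_shape_props(2,3) extend_tableau_props)
  then have "card (tableaux la (ka @ [a])) = card (Sigma (down la a) (\<lambda>ta. tableaux ta ka))"
    by (rule bij_betw_same_card)
  then show ?thesis by (simp add: card_SigmaI)
qed

text \<open>
Peeling off the boxes with the largest entry, one entry after the other, turns a tableau into a
chain of strips. The last exponent is the size of the outermost strip.
\<close>

lemma schur_nth: "schur la (Poly_Mapping.nth ka) = kostka la ka"
proof -
  have "int (card (tableaux la ka)) = kostka la ka"
  proof (induction ka arbitrary: la rule: rev_induct)
    case Nil
    show ?case
    proof (cases "la = empty_partition")
      case True
      then have "card (diagram la) = 0" by (simp add: card_diagram)
      then have d: "diagram la = {}" by simp
      have "row la i = 0" for i using True by simp
      then have "T \<in> tableaux la [] \<longleftrightarrow> T \<in> extensional {}" for T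
        unfolding tableaux_iff d by simp
      then have "tableaux la [] = {\<lambda>_. undefined}" unfolding extensional_empty by blast
      with True show ?thesis by (simp add: kostka_def delta_def)
    next
      case False
      then have "diagram la \<noteq> {}"
        using card_diagram[of la] psize_eq_0_iff[of la] by auto
      then obtain c where "c \<in> diagram la" by blast
      then have "tableaux la [] = {}" using tableaux_entry_less[of _ la "[]" c] by auto
      with False show ?thesis by (simp add: kostka_def delta_def)
    qed
  next
    case (snoc a ka)
    then show ?case by (simp add: card_tableaux_snoc kostka_def lower_def)
  qed
  then show ?thesis by (simp add: schur_def tableaux_def)
qed

section \<open>Transfer to formal power series\<close>

lemma nth_exponents:
  assumes "\<And>i. n \<le> i \<Longrightarrow> poly_mapping.lookup m i = 0"
  shows "Poly_Mapping.nth (map (poly_mapping.lookup m) [0..<n]) = m"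
  using assms by (intro poly_mapping_eqI) (simp add: nth_default_def)

lemma ex_nth: "\<exists>ka. m = Poly_Mapping.nth ka"
proof -
  obtain n where "\<forall>i \<in> Poly_Mapping.keys m. i < n"
    using finite_keys finite_nat_set_iff_bounded by blast
  then have "poly_mapping.lookup m i = 0" if "n \<le> i" for i
    using that by (metis in_keys_iff not_le)
  then have "m = Poly_Mapping.nth (map (poly_mapping.lookup m) [0..<n])" using nth_exponents[of n m] by simp
  then show ?thesis ..
qed

text \<open>
All factors of a monomial in the first \<open>length ka\<close> variables use only these variables,
so they are given by vectors of the same length.
\<close>

lemma series_mult_nth:
  "series_mult f g (Poly_Mapping.nth ka) = conv (\<lambda>x. f (Poly_Mapping.nth x)) (\<lambda>x. g (Poly_Mapping.nth x)) ka"
  unfolding series_mult_def conv_def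
proof (rule sum.reindex_bij_witness[where
      j = "\<lambda>(a, b). (map (poly_mapping.lookup a) [0..<length ka], map (poly_mapping.lookup b) [0..<length ka])" and
      i = "\<lambda>(x, y). (Poly_Mapping.nth x, Poly_Mapping.nth y)"])
  fix p :: "monom \<times> monom" assume "p \<in> {(a, b). a + b = Poly_Mapping.nth ka}"
  then obtain a b where p: "p = (a, b)" and ab: "a + b = Poly_Mapping.nth ka" by auto
  have sum: "poly_mapping.lookup a i + poly_mapping.lookup b i = nth_default 0 ka i" for i
    by (metis ab lookup_add lookup_nth)
  have z: "poly_mapping.lookup a i = 0" "poly_mapping.lookup b i = 0" if "length ka \<le> i" for i
    using sum[of i] that by (simp_all add: nth_default_def)
  have na: "Poly_Mapping.nth (map (poly_mapping.lookup a) [0..<length ka]) = a"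
    and nb: "Poly_Mapping.nth (map (poly_mapping.lookup b) [0..<length ka]) = b"
    by (intro nth_exponents z; assumption)+
  show "(case case p of (a, b) \<Rightarrow> (map (poly_mapping.lookup a) [0..<length ka], map (poly_mapping.lookup b) [0..<length ka]) of
      (x, y) \<Rightarrow> (Poly_Mapping.nth x, Poly_Mapping.nth y)) = p"
    by (simp add: p na nb)
  show "(case p of (a, b) \<Rightarrow> (map (poly_mapping.lookup a) [0..<length ka], map (poly_mapping.lookup b) [0..<length ka])) \<in> splits ka"
    using sum by (auto simp: p splits_iff nth_default_def intro!: nth_equalityI)
  show "(case case p of (a, b) \<Rightarrow> (map (poly_mapping.lookup a) [0..<length ka], map (poly_mapping.lookup b) [0..<length ka]) of
      (x, y) \<Rightarrow> f (Poly_Mapping.nth x) * g (Poly_Mapping.nth y)) = (case p of (a, b) \<Rightarrow> f a * g b)"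
    by (simp add: p na nb)
next
  fix q assume q: "q \<in> splits ka"
  then obtain x y where p: "q = (x, y)" and len: "length x = length y" and xy: "map2 (+) x y = ka"
    by (cases q) (auto simp: splits_iff)
  have "map (nth_default 0 x) [0..<length ka] = x" "map (nth_default 0 y) [0..<length ka] = y"
    unfolding xy[symmetric] using len by (auto intro!: nth_equalityI simp: nth_default_def)
  then show "(case case q of (x, y) \<Rightarrow> (Poly_Mapping.nth x, Poly_Mapping.nth y) of
      (a, b) \<Rightarrow> (map (poly_mapping.lookup a) [0..<length ka], map (poly_mapping.lookup b) [0..<length ka])) = q"
    by (simp add: p)
  have "nth_default 0 x i + nth_default 0 y i = nth_default 0 ka i" for i
    unfolding xy[symmetric] using len by (auto simp: nth_default_def)
  then have "Poly_Mapping.nth x + Poly_Mapping.nth y = Poly_Mapping.nth ka"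
    by (intro poly_mapping_eqI) (simp add: lookup_add)
  then show "(case q of (x, y) \<Rightarrow> (Poly_Mapping.nth x, Poly_Mapping.nth y)) \<in> {(a, b). a + b = Poly_Mapping.nth ka}"
    by (simp add: p)
qed

lemma schur_expansion_iff:
  "schur_expansion (series_mult (schur la) (schur mu)) c \<longleftrightarrow> finite {nu. c nu \<noteq> 0} \<and>
    (\<forall>ka. conv (kostka la) (kostka mu) ka = (\<Sum>nu | c nu \<noteq> 0. c nu * kostka nu ka))"
  (is "?l \<longleftrightarrow> ?r")
proof -
  have "(\<forall>m. series_mult (schur la) (schur mu) m = (\<Sum>nu | c nu \<noteq> 0. c nu * schur nu m)) \<longleftrightarrow>
     (\<forall>ka. series_mult (schur la) (schur mu) (Poly_Mapping.nth ka) =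
       (\<Sum>nu | c nu \<noteq> 0. c nu * schur nu (Poly_Mapping.nth ka)))"
    using ex_nth by metis
  then show ?thesis
    by (simp add: schur_expansion_def fun_eq_iff series_mult_nth schur_nth)
qed

lemma schur_expansion_lr: "schur_expansion (series_mult (schur la) (schur mu)) (lr la mu)"
proof -
  have sub: "{nu. lr la mu nu \<noteq> 0} \<subseteq> {nu. psize nu = psize la + psize mu}"
    using lr_support by auto
  have "conv (kostka la) (kostka mu) ka = (\<Sum>nu | lr la mu nu \<noteq> 0. lr la mu nu * kostka nu ka)" for ka
  proof -
    have "conv (kostka la) (kostka mu) ka = (\<Sum>nu | psize nu = psize la + psize mu. lr la mu nu * kostka nu ka)"
      by (rule conv_kostka) simp
    also have "\<dots> = (\<Sum>nu | lr la mu nu \<noteq> 0. lr la mu nu * kostka nu ka)"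
      using sub by (intro sum.mono_neutral_right) auto
    finally show ?thesis .
  qed
  then show ?thesis
    unfolding schur_expansion_iff using finite_subset[OF sub] by simp
qed

text \<open>
The definite description in the definition of \<open>lr_coeff\<close> denotes: expansions exist, and
they are unique even among those that are not assumed to be homogeneous.
\<close>

lemma lr_coeff_eq_lr: "lr_coeff la mu = lr la mu"
  unfolding lr_coeff_def
proof (rule the_equality, rule schur_expansion_lr)
  fix c assume c: "schur_expansion (series_mult (schur la) (schur mu)) c"
  let ?A = "{nu. c nu \<noteq> 0} \<union> {nu. lr la mu nu \<noteq> 0}"
  note e = c[unfolded schur_expansion_iff] schur_expansion_lr[of la mu, unfolded schur_expansion_iff]
  have fin: "finite ?A" using e by simp
  have zero: "(\<Sum>nu\<in>?A. (c nu - lr la mu nu) * kostka nu ka) = 0" for ka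
  proof -
    have "(\<Sum>nu\<in>?A. c nu * kostka nu ka) = (\<Sum>nu | c nu \<noteq> 0. c nu * kostka nu ka)"
      using fin by (intro sum.mono_neutral_right) auto
    also have "\<dots> = conv (kostka la) (kostka mu) ka" using e by simp
    also have "\<dots> = (\<Sum>nu | lr la mu nu \<noteq> 0. lr la mu nu * kostka nu ka)" using e by blast
    also have "\<dots> = (\<Sum>nu\<in>?A. lr la mu nu * kostka nu ka)"
      using fin by (intro sum.mono_neutral_left) auto
    finally show ?thesis by (simp add: left_diff_distrib sum_subtractf)
  qed
  show "c = lr la mu"
  proof
    fix nu
    show "c nu = lr la mu nu"
      using kostka_independent[of ?A "\<lambda>nu. c nu - lr la mu nu", OF fin zero, of nu]
      by (cases "nu \<in> ?A") auto
  qed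
qed

theorem corollary4p10:
  fixes la mu :: partition
  shows "schur_expansion (series_mult (schur la) (schur mu)) (lr_coeff la mu) \<and>
    finite {(al, be, nu). lr_coeff al nu la * lr_coeff be nu mu \<noteq> 0} \<and>
    (\<Sum>nu \<in> {nu. lr_coeff la mu nu \<noteq> 0}. lr_coeff la mu nu) =
      (\<Sum>(al, be, nu) \<in> {(al, be, nu). lr_coeff al nu la * lr_coeff be nu mu \<noteq> 0}.
        lr_coeff al nu la * lr_coeff be nu mu)"
  unfolding lr_coeff_eq_lr
proof (intro conjI)
  let ?S = "{(al, be, nu). lr al nu la * lr be nu mu \<noteq> 0}"
  let ?Q = "{nu. psize nu \<le> psize la}" and ?Q' = "{be. psize be \<le> psize mu}"
  show "schur_expansion (series_mult (schur la) (schur mu)) (lr la mu)"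
    by (rule schur_expansion_lr)
  have sub: "?S \<subseteq> ?Q \<times> ?Q' \<times> ?Q"
    using lr_support by fastforce
  then show "finite ?S" by (rule finite_subset) simp
  have "(\<Sum>nu | lr la mu nu \<noteq> 0. lr la mu nu) = (\<Sum>nu | psize nu = psize la + psize mu. lr mu la nu)"
    unfolding lr_commute[of la mu]
    using lr_support[of mu la] by (intro sum.mono_neutral_left) (auto simp: add.commute)
  also have "\<dots> = (\<Sum>(be, nu, ta) \<in> ?Q' \<times> ?Q \<times> ?Q. lr ta nu la * lr be ta mu)"
    unfolding lr_sum by (simp add: sum.cartesian_product case_prod_unfold)
  also have "\<dots> = (\<Sum>(al, be, nu) \<in> ?Q \<times> ?Q' \<times> ?Q. lr al nu la * lr be nu mu)"
    by (rule sum.reindex_bij_witness[where i = "\<lambda>(al, be, nu). (be, al, nu)" and j = "\<lambda>(be, al, nu). (al, be, nu)"])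
       (auto simp: lr_commute)
  also have "\<dots> = (\<Sum>(al, be, nu) \<in> ?S. lr al nu la * lr be nu mu)"
    using sub by (intro sum.mono_neutral_right) auto
  finally show "(\<Sum>nu | lr la mu nu \<noteq> 0. lr la mu nu) = (\<Sum>(al, be, nu) \<in> ?S. lr al nu la * lr be nu mu)" .
qed

end
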